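(* Let $G$ be a connected $4$-regular graph with $q(G)=2$. Then $G$ is isomorphic to one of the following: (1) $K_5$; (2) one of $R_{7,1}, R_{8,2}, R_{8,3}, R_{8,4}, R_{8,5}, R_{8,6}$; (3) $K_3\Box C_4$, $K_{3,3}\Box K_2$, or one of $R_{10,2}, R_{10,3}, R_{10,4}, R_{12,3}, R_{14,1}$; (4) the hypercube $Q_4$; or (5) a closed candle $H_k$ for some $k\ge 3$.
   Context: All graphs are finite, simple, undirected. For a connected graph $G$ on $n$ vertices, $\mathcal{S}(G)$ is the set of all real symmetric $n\times n$ matrices $A=[a_{ij}]$ such that for $i\neq j$, $a_{ij}\neq 0$ if and only if $\{i,j\}$ is an edge of $G$ (diagonal entries are arbitrary). $q(G)$ is the minimum number of distinct eigenvalues of a matrix in $\mathcal{S}(G)$. $\Box$ denotes the Cartesian product of graphs; $Q_4$ is the $4$-fold Cartesian product of $K_2$ with itself. The circulant graph $C(n,\pm i,\pm j)$ has vertex set $\mathbb{Z}/n\mathbb{Z}$ with $t$ adjacent to $t\pm i$ and $t\pm j$. For $k\ge 3$, the closed candle $H_k$ has vertex set $\{1,\dots,2k\}$; the odd vertices form a cycle $1,3,5,\dots,2k-1,1$, the even vertices form a cycle $2,4,\dots,2k,2$, and additionally an odd vertex $i$ is adjacent to an even vertex $j$ iff $j-i=3$, or $j-i=-1$, or $(i,j)=(2k-1,2)$, or $(i,j)=(1,2k)$. (It is $4$-regular.) The sporadic graphs are: $R_{7,1}=C(7,\pm1,\pm2)$; $R_{8,5}=K_4\Box K_2$; $R_{8,6}=C(8,\pm1,\pm2)$;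 $R_{10,4}=C(10,\pm1,\pm3)$; $R_{12,3}=C(12,\pm1,\pm3)$; $R_{8,2}$ on $\{1,\dots,8\}$ with edges $12,13,16,18,23,25,28,34,37,45,46,48,56,57,67,78$; $R_{8,3}$ on $\{1,\dots,8\}$ with edges $12,14,15,18,23,25,26,34,36,37,47,48,57,58,67,68$; $R_{8,4}$ on $\{1,\dots,8\}$ with edges $12,15,17,18,23,24,25,34,37,38,45,46,56,67,68,78$; $R_{10,2}$ on $\{1,\dots,10\}$ with edges $1\text{-}2,1\text{-}5,1\text{-}8,1\text{-}10,2\text{-}3,2\text{-}6,2\text{-}9,3\text{-}4,3\text{-}7,3\text{-}10,4\text{-}5,4\text{-}8,4\text{-}9,5\text{-}6,5\text{-}10,6\text{-}7,6\text{-}9,7\text{-}8,7\text{-}10,8\text{-}9$; $R_{10,3}$ on $\{1,\dots,10\}$ with edges $1\text{-}2,1\text{-}3,1\text{-}4,1\text{-}5,2\text{-}3,2\text{-}4,2\text{-}5,6\text{-}7,6\text{-}8,6\text{-}9,6\text{-}10,7\text{-}8,7\text{-}9,7\text{-}10,3\text{-}8,3\text{-}10,4\text{-}8,4\text{-}9,5\text{-}9,5\text{-}10$ (equivalently, obtained from the cube $Q_3$ by adding, for each vertex $x$ of a pair of antipodal vertices, a new vertex adjacent to $x$ and to all neighbors of $x$); $R_{14,1}$ on $\{1,\dots,14\}$, bipartite with vertex $i\in\{1,\dots,7\}$ adjacent to: $1:\{8,10,13,14\}$, $2:\{8,9,11,14\}$, $3:\{8,9,10,12\}$, $4:\{9,10,11,13\}$,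 $5:\{10,11,12,14\}$, $6:\{8,11,12,13\}$, $7:\{9,12,13,14\}$. *)

theory Defs
  imports
    "Graph_Theory.Graph_Theory"
    "Jordan_Normal_Form.Spectral_Radius"
begin

text \<open>
  Finite simple undirected graphs are the symmetric loop-free pair digraphs of the locale
  \<^locale>\<open>pair_graph\<close>: an edge \<open>{u, v}\<close> is represented by the two arcs \<open>(u, v)\<close> and
  \<open>(v, u)\<close>, so the degree of a vertex is its out-degree.
\<close>

abbreviation graph_iso :: "'a pair_pre_digraph \<Rightarrow> 'b pair_pre_digraph \<Rightarrow> bool" where
  "graph_iso G H \<equiv> digraph_iso (with_proj G) (with_proj H)"

text \<open>
  The set \<open>\<S>(G)\<close>. Rows and columns of a matrix are numbered \<open>0, \<dots>, n - 1\<close>, so the vertices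
  have to be numbered as well; every numbering \<open>\<nu>\<close> is admitted. Renumbering conjugates by a
  permutation matrix and does not change the spectrum.
\<close>

definition sym_mats :: "'a pair_pre_digraph \<Rightarrow> real mat set" where
  "sym_mats G = {A. A \<in> carrier_mat (card (pverts G)) (card (pverts G)) \<and> transpose_mat A = A \<and>
     (\<exists>\<nu>. bij_betw \<nu> {..<card (pverts G)} (pverts G) \<and>
       (\<forall>i<card (pverts G). \<forall>j<card (pverts G). i \<noteq> j \<longrightarrow>
          (A $$ (i, j) \<noteq> 0 \<longleftrightarrow> (\<nu> i, \<nu> j) \<in> parcs G)))}"

definition q_graph :: "'a pair_pre_digraph \<Rightarrow> nat" where
  "q_graph G = (LEAST m. \<exists>A \<in> sym_mats G. m = card (spectrum A))"

definition undirected :: "'a set \<Rightarrow> ('a \<times> 'a) set \<Rightarrow> 'a pair_pre_digraph" where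
  "undirected V E = \<lparr> pverts = V, parcs = E \<union> E\<inverse> \<rparr>"

definition complete_graph :: "nat \<Rightarrow> nat pair_pre_digraph" where
  "complete_graph n = undirected {..<n} {(u, v). u < n \<and> v < n \<and> u \<noteq> v}"

definition complete_bipartite_graph :: "nat \<Rightarrow> nat \<Rightarrow> (nat + nat) pair_pre_digraph" where
  "complete_bipartite_graph m n =
     undirected ({..<m} <+> {..<n}) {(Inl u, Inr v) | u v. u < m \<and> v < n}"

text \<open>
  \<open>C(n, \<plusminus>d : d \<in> D)\<close>, with \<open>\<int>/n\<int>\<close> represented by the residues \<open>0, \<dots>, n - 1\<close>.
\<close>

definition circulant :: "nat \<Rightarrow> nat set \<Rightarrow> nat pair_pre_digraph" where
  "circulant n D = undirected {..<n} {(t, (t + d) mod n) | t d. t < n \<and> d \<in> D}"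

definition cycle_graph :: "nat \<Rightarrow> nat pair_pre_digraph" where
  "cycle_graph n = circulant n {1}"

definition cartesian_product ::
    "'a pair_pre_digraph \<Rightarrow> 'b pair_pre_digraph \<Rightarrow> ('a \<times> 'b) pair_pre_digraph"
    (infixl \<open>\<box>\<close> 70) where
  "G \<box> H = \<lparr> pverts = pverts G \<times> pverts H,
     parcs = {((u, v), (u', v')) | u v u' v'.
       (u = u' \<and> u \<in> pverts G \<and> (v, v') \<in> parcs H) \<or>
       ((u, u') \<in> parcs G \<and> v = v' \<and> v \<in> pverts H)} \<rparr>"

definition hypercube4 :: "(((nat \<times> nat) \<times> nat) \<times> nat) pair_pre_digraph" where
  "hypercube4 = complete_graph 2 \<box> complete_graph 2 \<box> complete_graph 2 \<box> complete_graph 2"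

definition closed_candle :: "nat \<Rightarrow> nat pair_pre_digraph" where
  "closed_candle k = undirected {1..2*k}
     ({(i, i + 2) | i. odd i \<and> i + 2 \<le> 2*k - 1} \<union> {(2*k - 1, 1)} \<union>
      {(i, i + 2) | i. even i \<and> 2 \<le> i \<and> i + 2 \<le> 2*k} \<union> {(2*k, 2)} \<union>
      {(i, j). i \<in> {1..2*k} \<and> j \<in> {1..2*k} \<and> odd i \<and> even j \<and>
         (int j - int i = 3 \<or> int j - int i = -1 \<or> (i, j) = (2*k - 1, 2) \<or> (i, j) = (1, 2*k))})"

definition R_7_1 :: "nat pair_pre_digraph" where
  "R_7_1 = circulant 7 {1, 2}"

definition R_8_2 :: "nat pair_pre_digraph" where
  "R_8_2 = undirected {1..8}
     {(1,2), (1,3), (1,6), (1,8), (2,3), (2,5), (2,8), (3,4),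
      (3,7), (4,5), (4,6), (4,8), (5,6), (5,7), (6,7), (7,8)}"

definition R_8_3 :: "nat pair_pre_digraph" where
  "R_8_3 = undirected {1..8}
     {(1,2), (1,4), (1,5), (1,8), (2,3), (2,5), (2,6), (3,4),
      (3,6), (3,7), (4,7), (4,8), (5,7), (5,8), (6,7), (6,8)}"

definition R_8_4 :: "nat pair_pre_digraph" where
  "R_8_4 = undirected {1..8}
     {(1,2), (1,5), (1,7), (1,8), (2,3), (2,4), (2,5), (3,4),
      (3,7), (3,8), (4,5), (4,6), (5,6), (6,7), (6,8), (7,8)}"

definition R_8_5 :: "(nat \<times> nat) pair_pre_digraph" where
  "R_8_5 = complete_graph 4 \<box> complete_graph 2"

definition R_8_6 :: "nat pair_pre_digraph" where
  "R_8_6 = circulant 8 {1, 2}"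

definition R_10_2 :: "nat pair_pre_digraph" where
  "R_10_2 = undirected {1..10}
     {(1,2), (1,5), (1,8), (1,10), (2,3), (2,6), (2,9), (3,4), (3,7), (3,10),
      (4,5), (4,8), (4,9), (5,6), (5,10), (6,7), (6,9), (7,8), (7,10), (8,9)}"

definition R_10_3 :: "nat pair_pre_digraph" where
  "R_10_3 = undirected {1..10}
     {(1,2), (1,3), (1,4), (1,5), (2,3), (2,4), (2,5), (6,7), (6,8), (6,9),
      (6,10), (7,8), (7,9), (7,10), (3,8), (3,10), (4,8), (4,9), (5,9), (5,10)}"

definition R_10_4 :: "nat pair_pre_digraph" where
  "R_10_4 = circulant 10 {1, 3}"

definition R_12_3 :: "nat pair_pre_digraph" where
  "R_12_3 = circulant 12 {1, 3}"

definition R_14_1 :: "nat pair_pre_digraph" where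
  "R_14_1 = undirected {1..14}
     ({1} \<times> {8, 10, 13, 14} \<union> {2} \<times> {8, 9, 11, 14} \<union> {3} \<times> {8, 9, 10, 12} \<union>
      {4} \<times> {9, 10, 11, 13} \<union> {5} \<times> {10, 11, 12, 14} \<union> {6} \<times> {8, 11, 12, 13} \<union>
      {7} \<times> {9, 12, 13, 14})"

end

theory Submission
  imports Defs "Jordan_Normal_Form.Jordan_Normal_Form_Uniqueness"
begin

text \<open>
  A symmetric matrix with two distinct eigenvalues satisfies a quadratic equation. Reading off
  its off-diagonal entries, two non-adjacent vertices never have exactly one common neighbour,
  and if they have exactly two, the four weights of the resulting quadrangle have negative product;
  an edge in no triangle has opposite (shifted) diagonal entries at its ends.

  The first condition alone is so restrictive for connected 4-regular graphs that an exhaustive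
  search ends after some 500 steps in one of 23 graphs or in five consecutive twin pairs of a candle.
  Such a sequence of twin pairs extends until it closes up. Five of the 23 graphs are excluded by the
  sign and diagonal conditions.
\<close>

section \<open>Symmetric matrices\<close>

lemma symmetric_mat_entry_commute:
  assumes "A \<in> carrier_mat n n" "transpose_mat A = A" "i < n" "j < n"
  shows "A $$ (i, j) = A $$ (j, i)"
  using assms by (metis carrier_matD index_transpose_mat(1))

lemma symmetric_mat_square_entry:
  fixes A :: "'a :: semiring_0 mat"
  assumes A: "A \<in> carrier_mat n n" "transpose_mat A = A"
    and \<mu>: "bij_betw \<mu> V {..<n}" and uv: "u \<in> V" "v \<in> V"
  shows "(A * A) $$ (\<mu> u, \<mu> v) = (\<Sum>x\<in>V. A $$ (\<mu> u, \<mu> x) * A $$ (\<mu> v, \<mu> x))"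
proof -
  have \<mu>_less: "\<mu> u < n" "\<mu> v < n" using bij_betwE[OF \<mu>] uv by auto
  have "(A * A) $$ (\<mu> u, \<mu> v) = (\<Sum>k<n. A $$ (\<mu> u, k) * A $$ (k, \<mu> v))"
    using A \<mu>_less by (simp add: scalar_prod_def atLeast0LessThan)
  also have "\<dots> = (\<Sum>k<n. A $$ (\<mu> u, k) * A $$ (\<mu> v, k))"
    using symmetric_mat_entry_commute[OF A \<mu>_less(2)] by (intro sum.cong) auto
  also have "\<dots> = (\<Sum>x\<in>V. A $$ (\<mu> u, \<mu> x) * A $$ (\<mu> v, \<mu> x))"
    by (rule sum.reindex_bij_betw[OF \<mu>, symmetric])
  finally show ?thesis .
qed

lemma real_symmetric_eigenvalue_real:
  fixes A :: "real mat"
  assumes A: "A \<in> carrier_mat n n" and sym: "transpose_mat A = A"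
    and ev: "eigenvalue (map_mat complex_of_real A) a"
  shows "a \<in> \<real>"
proof -
  let ?M = "map_mat complex_of_real A"
  have M: "?M \<in> carrier_mat n n" using A by auto
  have M_sym: "transpose_mat ?M = ?M" using sym by (metis map_mat_transpose)
  obtain v where v: "v \<in> carrier_vec n" "v \<noteq> 0\<^sub>v n"
    and M_v: "?M *\<^sub>v v = a \<cdot>\<^sub>v v"
    using ev A unfolding eigenvalue_def eigenvector_def by auto
  have conj_carrier: "conjugate v \<in> carrier_vec n" using v by auto
  have M_conj: "?M *\<^sub>v conjugate v = conjugate (?M *\<^sub>v v)"
    using A v(1) by (intro eq_vecI) (auto simp: scalar_prod_def sum_conjugate)
  have "a * (v \<bullet>c v) = (?M *\<^sub>v v) \<bullet>c v" using v conj_carrier M_v by simp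
  also have "\<dots> = v \<bullet> (?M *\<^sub>v conjugate v)"
    using transpose_vec_mult_scalar[OF M v(1) conj_carrier] M_sym comm_scalar_prod v(1) conj_carrier M
    by (metis mult_mat_vec_carrier)
  also have "\<dots> = conjugate a * (v \<bullet>c v)"
    using v conj_carrier unfolding M_conj M_v by (simp add: conjugate_smult_vec)
  finally have "a = conjugate a" using conjugate_square_eq_0_vec[OF v(1)] v(2) by simp
  then show ?thesis by (metis Reals_cnj_iff conjugate_complex_def)
qed

lemma real_symmetric_char_poly_splits:
  fixes A :: "real mat"
  assumes A: "A \<in> carrier_mat n n" and sym: "transpose_mat A = A"
  obtains as where "char_poly A = (\<Prod>a\<leftarrow>as. [:- a, 1:])"
proof -
  let ?M = "map_mat complex_of_real A"
  interpret of_real: map_poly_inj_idom_hom complex_of_real ..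
  have M: "?M \<in> carrier_mat n n" using A by auto
  obtain as where as: "char_poly ?M = (\<Prod>a\<leftarrow>as. [:- a, 1:])"
    using char_poly_factorized[OF M] by auto
  have "a \<in> \<real>" if "a \<in> set as" for a
  proof (rule real_symmetric_eigenvalue_real[OF A sym])
    have "poly (char_poly ?M) a = 0" unfolding as using that by (simp add: poly_prod_list)
    then show "eigenvalue ?M a" using eigenvalue_root_char_poly[OF M] by simp
  qed
  then have Re: "map (\<lambda>a. complex_of_real (Re a)) as = as" by (auto intro!: map_idI)
  have "map_poly complex_of_real (char_poly A) = char_poly ?M"
    by (rule of_real_hom.char_poly_hom[OF A, symmetric])
  also have "\<dots> = (\<Prod>a\<leftarrow>map (\<lambda>a. complex_of_real (Re a)) as. [:- a, 1:])"
    unfolding Re by (rule as)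
  also have "\<dots> = map_poly complex_of_real (\<Prod>a\<leftarrow>map Re as. [:- a, 1:])"
    by (induction as) (simp_all add: of_real.hom_mult del: mult_pCons_left)
  finally have "char_poly A = (\<Prod>a\<leftarrow>map Re as. [:- a, 1:])" by simp
  then show thesis by (rule that)
qed

definition mat_trace :: "'a :: comm_monoid_add mat \<Rightarrow> 'a" where
  "mat_trace A = (\<Sum>i<dim_row A. A $$ (i, i))"

lemma mat_trace_mult_comm:
  fixes A B :: "'a :: comm_semiring_0 mat"
  assumes A: "A \<in> carrier_mat n m" and B: "B \<in> carrier_mat m n"
  shows "mat_trace (A * B) = mat_trace (B * A)"
proof -
  have "mat_trace (A * B) = (\<Sum>i<n. \<Sum>j<m. A $$ (i, j) * B $$ (j, i))"
    using A B by (simp add: mat_trace_def scalar_prod_def atLeast0LessThan)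
  also have "\<dots> = (\<Sum>j<m. \<Sum>i<n. B $$ (j, i) * A $$ (i, j))"
    by (subst sum.swap) (simp add: mult.commute)
  also have "\<dots> = mat_trace (B * A)"
    using A B by (simp add: mat_trace_def scalar_prod_def atLeast0LessThan)
  finally show ?thesis .
qed

lemma similar_mat_trace_eq:
  fixes A :: "'a :: comm_ring_1 mat"
  assumes "similar_mat_wit A B P Q"
  shows "mat_trace A = mat_trace B"
proof -
  define n where "n = dim_row A"
  note wit = similar_mat_witD[OF n_def assms]
  have "mat_trace A = mat_trace (Q * (P * B))"
    unfolding wit(3) by (rule mat_trace_mult_comm[of _ n n]) (use wit(5-7) in auto)
  also have "Q * (P * B) = B"
    using wit(2,5,6,7) by (simp add: assoc_mult_mat[of Q n n P n B n, symmetric])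
  finally show ?thesis .
qed

lemma mat_trace_transpose_mult_eq_0:
  fixes A :: "real mat"
  assumes A: "A \<in> carrier_mat n m" and trace: "mat_trace (transpose_mat A * A) = 0"
  shows "A = 0\<^sub>m n m"
proof (rule eq_matI)
  have "mat_trace (transpose_mat A * A) = (\<Sum>j<m. \<Sum>i<n. (A $$ (i, j))\<^sup>2)"
    using A by (simp add: mat_trace_def scalar_prod_def atLeast0LessThan power2_eq_square)
  then have "(\<Sum>i<n. (A $$ (i, j))\<^sup>2) = 0" if "j < m" for j
    using trace that by (simp add: sum_nonneg_eq_0_iff sum_nonneg)
  then show "A $$ (i, j) = 0\<^sub>m n m $$ (i, j)" if "i < dim_row (0\<^sub>m n m :: real mat)"
    "j < dim_col (0\<^sub>m n m :: real mat)" for i j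
    using that by (simp add: sum_nonneg_eq_0_iff)
qed (use A in auto)

lemma upper_triangular_mult:
  fixes A B :: "'a :: semiring_0 mat"
  assumes A: "A \<in> carrier_mat n n" "upper_triangular A"
    and B: "B \<in> carrier_mat n n" "upper_triangular B"
  shows "upper_triangular (A * B)" "i < n \<Longrightarrow> (A * B) $$ (i, i) = A $$ (i, i) * B $$ (i, i)"
proof -
  have entry: "(A * B) $$ (i, j) = (\<Sum>k<n. A $$ (i, k) * B $$ (k, j))" if "i < n" "j < n" for i j
    using A B that by (simp add: scalar_prod_def atLeast0LessThan)
  have below: "A $$ (i, k) * B $$ (k, j) = 0"
    if "i < n" "j \<le> i" "k < n" "\<not> (k = i \<and> j = i)" for i j k
    using upper_triangularD[OF A(2), of k i] upper_triangularD[OF B(2), of j k] A(1) B(1) that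
    by (cases "k < i") auto
  show "upper_triangular (A * B)"
  proof (rule upper_triangularI)
    fix i j assume "j < i" "i < dim_row (A * B)"
    then show "(A * B) $$ (i, j) = 0" using A(1) entry below by (auto intro!: sum.neutral)
  qed
  assume i: "i < n"
  have "(\<Sum>k<n. A $$ (i, k) * B $$ (k, i)) = (\<Sum>k\<in>{i}. A $$ (i, k) * B $$ (k, i))"
    by (rule sum.mono_neutral_right) (use i below in auto)
  then show "(A * B) $$ (i, i) = A $$ (i, i) * B $$ (i, i)" using entry i by simp
qed

lemma similar_mat_wit_mult:
  assumes AB: "similar_mat_wit A B P Q" and AB': "similar_mat_wit A' B' P Q"
  shows "similar_mat_wit (A * A') (B * B') P Q"
proof -
  define n where "n = dim_row A"
  note wit = similar_mat_witD[OF n_def AB]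
  have "dim_row A' = n" using wit(6) similar_mat_witD(6)[OF refl AB'] by auto
  note wit' = similar_mat_witD[OF this[symmetric] AB']
  note carrier = wit(4-7) wit'(4,5)
  note [simp] = assoc_mult_mat[of _ n n _ n _ n]
  have "A * A' = P * (B * ((Q * P) * (B' * Q)))"
    unfolding wit(3) wit'(3) using carrier by simp
  also have "\<dots> = P * (B * B') * Q" unfolding wit(2) using carrier by simp
  finally show ?thesis
    by (rule similar_mat_witI[OF wit(1,2)]) (use carrier in auto)
qed

primrec char_matrix_prod :: "'a :: field mat \<Rightarrow> 'a list \<Rightarrow> 'a mat" where
  "char_matrix_prod A [] = 1\<^sub>m (dim_row A)"
| "char_matrix_prod A (e # es) = char_matrix A e * char_matrix_prod A es"

lemma char_matrix_prod_carrier [simp]: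
  "A \<in> carrier_mat n n \<Longrightarrow> char_matrix_prod A es \<in> carrier_mat n n"
  by (induction es) (auto intro: mult_carrier_mat[of _ n n _ n])

lemma char_matrix_prod_append:
  assumes "A \<in> carrier_mat n n"
  shows "char_matrix_prod A (es @ fs) = char_matrix_prod A es * char_matrix_prod A fs"
proof (induction es)
  case Nil
  show ?case using left_mult_one_mat[OF char_matrix_prod_carrier[OF assms]] assms by simp
next
  case (Cons e es)
  then show ?case
    using assms by (simp add: assoc_mult_mat[of "char_matrix A e" n n _ n _ n])
qed

lemma transpose_char_matrix_prod:
  assumes A: "A \<in> carrier_mat n n" and sym: "transpose_mat A = A"
  shows "transpose_mat (char_matrix_prod A es) = char_matrix_prod A (rev es)"
proof (induction es)
  case (Cons e es)
  have "transpose_mat (char_matrix A e) = char_matrix A e"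
  proof (rule eq_matI)
    fix i j assume "i < dim_row (char_matrix A e)" "j < dim_col (char_matrix A e)"
    then have "i < n" "j < n" using char_matrix_closed[OF A, of e] by auto
    moreover from this have "A $$ (i, j) = A $$ (j, i)"
      by (rule symmetric_mat_entry_commute[OF A sym])
    ultimately show "transpose_mat (char_matrix A e) $$ (i, j) = char_matrix A e $$ (i, j)"
      using A by (auto simp: char_matrix_def)
  qed (use A in \<open>auto simp: char_matrix_def\<close>)
  then have "transpose_mat (char_matrix_prod A (e # es)) =
      char_matrix_prod A (rev es) * char_matrix A e"
    using A Cons by (simp add: transpose_mult[of _ n n _ n])
  then show ?case
    using A right_mult_one_mat[OF char_matrix_closed[OF A]]
    by (simp add: char_matrix_prod_append[OF A])
qed (use A in simp)

lemma similar_mat_wit_char_matrix_prod: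
  assumes "similar_mat_wit A B P Q"
  shows "similar_mat_wit (char_matrix_prod A es) (char_matrix_prod B es) P Q"
proof (induction es)
  case Nil
  define n where "n = dim_row A"
  note wit = similar_mat_witD[OF n_def assms]
  have "dim_row B = n" using wit(5) by simp
  then show ?case
    unfolding char_matrix_prod.simps n_def[symmetric]
    by (intro similar_mat_witI[OF wit(1,2)]) (use wit(1,6,7) in auto)
next
  case (Cons e es)
  then show ?case using similar_mat_wit_mult[OF similar_mat_wit_char_matrix[OF assms]] by simp
qed

lemma upper_triangular_char_matrix_prod:
  assumes B: "B \<in> carrier_mat n n" "upper_triangular B"
  shows "upper_triangular (char_matrix_prod B es) \<and>
    (\<forall>i<n. char_matrix_prod B es $$ (i, i) = (\<Prod>e\<leftarrow>es. B $$ (i, i) - e))"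
proof (induction es)
  case Nil
  show ?case using B by simp
next
  case (Cons e es)
  have "upper_triangular (char_matrix B e)"
    using B by (auto simp: char_matrix_def upper_triangular_def)
  moreover have "char_matrix B e $$ (i, i) = B $$ (i, i) - e" if "i < n" for i
    using B that by (simp add: char_matrix_def)
  ultimately show ?case
    using B Cons upper_triangular_mult[of "char_matrix B e" n "char_matrix_prod B es"] by simp
qed

text \<open>
  Schur triangularization makes the product \<open>M\<close> of the matrices \<open>A - \<lambda> I\<close> upper triangular with zero
  diagonal, and likewise \<open>M\<^sup>T M\<close>. So the trace of the latter, the sum of the squared entries of \<open>M\<close>,
  is 0.
\<close>

theorem real_symmetric_char_matrix_prod_eq_0:
  fixes A :: "real mat"
  assumes A: "A \<in> carrier_mat n n" and sym: "transpose_mat A = A" and es: "spectrum A \<subseteq> set es"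
  shows "char_matrix_prod A es = 0\<^sub>m n n" (is "?M = _")
proof (rule mat_trace_transpose_mult_eq_0)
  show "?M \<in> carrier_mat n n" using A by simp
  obtain as where as: "char_poly A = (\<Prod>a\<leftarrow>as. [:- a, 1:])"
    by (rule real_symmetric_char_poly_splits[OF A sym])
  obtain B P Q where schur: "schur_decomposition A as = (B, P, Q)" by (metis prod_cases3)
  have sim: "similar_mat_wit A B P Q" and B: "upper_triangular B" and diag: "diag_mat B = as"
    using schur_decomposition[OF A as schur] by auto
  have carrier: "B \<in> carrier_mat n n" using similar_mat_witD2[OF A sim] by auto
  have "B $$ (i, i) \<in> set es" if "i < n" for i
  proof -
    have "B $$ (i, i) \<in> set as" using that carrier unfolding diag[symmetric] diag_mat_def by auto
    then have "poly (char_poly A) (B $$ (i, i)) = 0" unfolding as by (simp add: poly_prod_list)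
    then show ?thesis using es spectrum_root_char_poly[OF A] by auto
  qed
  then have "char_matrix_prod B (rev es @ es) $$ (i, i) = 0" if "i < n" for i
    using upper_triangular_char_matrix_prod[OF carrier B, of "rev es @ es"] that
    by (auto simp: prod_list_zero_iff)
  then have "mat_trace (char_matrix_prod B (rev es @ es)) = 0"
    using char_matrix_prod_carrier[OF carrier, of "rev es @ es"]
    by (auto simp: mat_trace_def intro!: sum.neutral)
  then show "mat_trace (transpose_mat ?M * ?M) = 0"
    unfolding transpose_char_matrix_prod[OF A sym] char_matrix_prod_append[OF A, symmetric]
    using similar_mat_trace_eq[OF similar_mat_wit_char_matrix_prod[OF sim, of "rev es @ es"]]
    by simp
qed

corollary real_symmetric_two_eigenvalues_square:
  fixes A :: "real mat"
  assumes A: "A \<in> carrier_mat n n" and sym: "transpose_mat A = A"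
    and spectrum: "spectrum A = {l, m}" and ij: "i < n" "j < n" "i \<noteq> j"
  shows "(A * A) $$ (i, j) = (l + m) * A $$ (i, j)"
proof -
  let ?L = "- l \<cdot>\<^sub>m 1\<^sub>m n" and ?M = "- m \<cdot>\<^sub>m 1\<^sub>m n"
  have carrier: "?L \<in> carrier_mat n n" "?M \<in> carrier_mat n n" "A + ?L \<in> carrier_mat n n"
    using A by auto
  have "0\<^sub>m n n = (A + ?L) * (A + ?M)"
    using real_symmetric_char_matrix_prod_eq_0[OF A sym, of "[l, m]"] A spectrum
    by (simp add: char_matrix_def)
  also have "\<dots> = (A * A + ?L * A) + (A + ?L) * ?M"
    unfolding mult_add_distrib_mat[OF carrier(3) A carrier(2)]
      add_mult_distrib_mat[OF A carrier(1) A] ..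
  also have "\<dots> = (A * A + - l \<cdot>\<^sub>m A) + - m \<cdot>\<^sub>m (A + ?L)"
    using A mult_smult_distrib[OF carrier(3) one_carrier_mat, of "- m"]
      mult_smult_assoc_mat[OF one_carrier_mat A, of "- l"] by simp
  finally have "(0\<^sub>m n n :: real mat) $$ (i, j) = \<dots> $$ (i, j)" by (rule arg_cong)
  then show ?thesis using A ij by (simp add: distrib_right)
qed

section \<open>Weightings with two eigenvalues\<close>

abbreviation (in pair_graph) adj :: "'a \<Rightarrow> 'a \<Rightarrow> bool" where
  "adj u v \<equiv> (u, v) \<in> parcs G"

text \<open>
  The square of the matrix with entries \<open>w\<close> off the diagonal and \<open>d\<close> on it is diagonal. Such a
  matrix arises from one with two eigenvalues by subtracting their mean.
\<close>

locale two_eigenvalue_weighting = pair_graph G for G :: "'a pair_pre_digraph" +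
  fixes w :: "'a \<Rightarrow> 'a \<Rightarrow> real" and d :: "'a \<Rightarrow> real"
  assumes weight_commute: "w u v = w v u"
    and weight_nonzero_iff: "w u v \<noteq> 0 \<longleftrightarrow> (u, v) \<in> parcs G"
    and weight_orthogonal: "u \<in> pverts G \<Longrightarrow> v \<in> pverts G \<Longrightarrow> u \<noteq> v \<Longrightarrow>
      (d u + d v) * w u v + (\<Sum>x\<in>pverts G. w u x * w v x) = 0"
begin

lemma weight_orthogonal_common_neighbours:
  assumes "u \<in> pverts G" "v \<in> pverts G" "u \<noteq> v"
  shows "(d u + d v) * w u v + (\<Sum>x | adj u x \<and> adj v x. w u x * w v x) = 0"
proof -
  have "(\<Sum>x\<in>pverts G. w u x * w v x) =
      (\<Sum>x | adj u x \<and> adj v x. w u x * w v x)"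
    using weight_nonzero_iff in_arcsD2 by (intro sum.mono_neutral_right pair_finite_verts) auto
  then show ?thesis using weight_orthogonal[OF assms] by simp
qed

lemma second_common_neighbour:
  assumes "u \<noteq> v" "\<not> adj u v" "adj u x" "adj v x"
  obtains y where "y \<noteq> x" "adj u y" "adj v y"
proof -
  have "{y. adj u y \<and> adj v y} \<noteq> {x}"
  proof
    assume "{y. adj u y \<and> adj v y} = {x}"
    then have "w u x * w v x = 0"
      using weight_orthogonal_common_neighbours[of u v] weight_nonzero_iff[of u v] assms in_arcsD1
      by auto
    then show False using assms weight_nonzero_iff by auto
  qed
  then show thesis using assms that by auto
qed

lemma common_neighbour_pair_product_negative:
  assumes "u \<in> pverts G" "v \<in> pverts G" "u \<noteq> v" "\<not> adj u v" "x \<noteq> y"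
    and common: "{z. adj u z \<and> adj v z} = {x, y}"
  shows "(w u x * w v x) * (w u y * w v y) < 0"
proof -
  have "w u v = 0" using weight_nonzero_iff assms(4) by blast
  then have "w u x * w v x + w u y * w v y = 0"
    using weight_orthogonal_common_neighbours[OF assms(1-3)] \<open>x \<noteq> y\<close> unfolding common by simp
  then have "(w u x * w v x) * (w u y * w v y) = - ((w u x * w v x)\<^sup>2)"
    by (simp add: power2_eq_square add_eq_0_iff)
  moreover have "w u x * w v x \<noteq> 0" using common weight_nonzero_iff by auto
  ultimately show ?thesis by simp
qed

lemma diagonal_opposite_if_no_common_neighbour:
  assumes arc: "adj u v" and none: "{x. adj u x \<and> adj v x} = {}"
  shows "d u + d v = 0"
proof -
  have "u \<in> pverts G" "v \<in> pverts G" "u \<noteq> v" using arc in_arcsD1 in_arcsD2 no_loops' by auto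
  from weight_orthogonal_common_neighbours[OF this] show ?thesis
    using arc weight_nonzero_iff[of u v] unfolding none by simp
qed

end

lemma sym_mats_nonempty:
  assumes "finite (pverts G)" and sym: "\<And>u v. (u, v) \<in> parcs G \<Longrightarrow> (v, u) \<in> parcs G"
  shows "sym_mats G \<noteq> {}"
proof -
  let ?n = "card (pverts G)"
  obtain \<nu> where \<nu>: "bij_betw \<nu> {..<?n} (pverts G)"
    using ex_bij_betw_nat_finite[OF assms(1)] by (auto simp: atLeast0LessThan)
  let ?A = "mat ?n ?n (\<lambda>(i, j). if (\<nu> i, \<nu> j) \<in> parcs G then 1 else 0 :: real)"
  have "transpose_mat ?A = ?A" by (rule eq_matI) (auto dest: sym)
  then have "?A \<in> sym_mats G" unfolding sym_mats_def using \<nu> by auto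
  then show ?thesis by blast
qed

lemma q_graph_attained:
  assumes "sym_mats G \<noteq> {}"
  obtains A where "A \<in> sym_mats G" "card (spectrum A) = q_graph G"
proof -
  have "\<exists>k. \<exists>A \<in> sym_mats G. k = card (spectrum A)" using assms by blast
  from LeastI_ex[OF this] show thesis using that unfolding q_graph_def by auto
qed

lemma sym_matsE:
  assumes "A \<in> sym_mats G"
  obtains \<mu> where "bij_betw \<mu> (pverts G) {..<card (pverts G)}"
    and "\<And>u v. u \<in> pverts G \<Longrightarrow> v \<in> pverts G \<Longrightarrow> u \<noteq> v \<Longrightarrow>
      A $$ (\<mu> u, \<mu> v) \<noteq> 0 \<longleftrightarrow> (u, v) \<in> parcs G"
proof -
  let ?V = "pverts G" and ?n = "card (pverts G)"
  obtain \<nu> where \<nu>: "bij_betw \<nu> {..<?n} ?V"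
    and nonzero_iff: "\<And>i j. i < ?n \<Longrightarrow> j < ?n \<Longrightarrow> i \<noteq> j \<Longrightarrow>
      A $$ (i, j) \<noteq> 0 \<longleftrightarrow> (\<nu> i, \<nu> j) \<in> parcs G"
    using assms unfolding sym_mats_def by auto
  define \<mu> where "\<mu> = the_inv_into {..<?n} \<nu>"
  have \<mu>: "bij_betw \<mu> ?V {..<?n}" unfolding \<mu>_def by (rule bij_betw_the_inv_into[OF \<nu>])
  have \<nu>\<mu>: "\<nu> (\<mu> u) = u" if "u \<in> ?V" for u
    unfolding \<mu>_def using \<nu> that by (simp add: bij_betw_def f_the_inv_into_f)
  show thesis
  proof (rule that[OF \<mu>])
    fix u v assume uv: "u \<in> ?V" "v \<in> ?V" "u \<noteq> v"
    then have "\<mu> u < ?n" "\<mu> v < ?n" "\<mu> u \<noteq> \<mu> v" using bij_betwE[OF \<mu>] \<nu>\<mu> by auto metis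
    from nonzero_iff[OF this] show "A $$ (\<mu> u, \<mu> v) \<noteq> 0 \<longleftrightarrow> (u, v) \<in> parcs G"
      using \<nu>\<mu> uv by simp
  qed
qed

lemma (in pair_graph) two_eigenvalue_weighting_if_sym_mats:
  assumes mem: "A \<in> sym_mats G" and spectrum: "spectrum A = {l, m}"
  obtains w d where "two_eigenvalue_weighting G w d"
proof -
  let ?V = "pverts G" and ?n = "card (pverts G)"
  have A: "A \<in> carrier_mat ?n ?n" "transpose_mat A = A" using mem unfolding sym_mats_def by auto
  obtain \<mu> where \<mu>: "bij_betw \<mu> ?V {..<?n}"
    and nonzero_iff: "\<And>u v. u \<in> ?V \<Longrightarrow> v \<in> ?V \<Longrightarrow> u \<noteq> v \<Longrightarrow> A $$ (\<mu> u, \<mu> v) \<noteq> 0 \<longleftrightarrow> adj u v"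
    using sym_matsE[OF mem] by blast
  have \<mu>_less: "\<mu> u < ?n" if "u \<in> ?V" for u using bij_betwE[OF \<mu>] that by auto
  define a where "a u v = A $$ (\<mu> u, \<mu> v)" for u v
  define w where "w u v = (if adj u v then a u v else 0)" for u v
  define d where "d u = a u u - (l + m) / 2" for u
  have a_eq: "a u v = w u v + (if u = v then a v v else 0)" if "u \<in> ?V" "v \<in> ?V" for u v
    using nonzero_iff[OF that] no_loops' by (auto simp: a_def w_def)
  have w_loop: "w u u = 0" for u using no_loops' by (auto simp: w_def)
  have "two_eigenvalue_weighting G w d"
  proof
    show w_commute: "w u v = w v u" for u v
      using symmetric_mat_entry_commute[OF A \<mu>_less \<mu>_less] arcs_symmetric in_arcsD1 in_arcsD2
      by (auto simp: w_def a_def)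
    show "w u v \<noteq> 0 \<longleftrightarrow> adj u v" for u v
      using nonzero_iff in_arcsD1 in_arcsD2 no_loops' by (auto simp: a_def w_def)
    fix u v assume uv: "u \<in> ?V" "v \<in> ?V" "u \<noteq> v"
    then have "\<mu> u \<noteq> \<mu> v" using inj_on_eq_iff[OF bij_betw_imp_inj_on[OF \<mu>]] by blast
    then have "(l + m) * w u v = (A * A) $$ (\<mu> u, \<mu> v)"
      using real_symmetric_two_eigenvalues_square[OF A spectrum \<mu>_less \<mu>_less] uv a_eq[of u v]
      by (simp add: a_def)
    also have "\<dots> = (\<Sum>x\<in>?V. a u x * a v x)"
      unfolding a_def by (rule symmetric_mat_square_entry[OF A \<mu> uv(1,2)])
    also have "\<dots> = (\<Sum>x\<in>?V. w u x * w v x + (if u = x then a u u * w v u else 0) +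
        (if v = x then a v v * w u v else 0))"
      by (rule sum.cong) (use uv in \<open>auto simp: a_eq[of u] a_eq[of v] w_loop algebra_simps\<close>)
    also have "\<dots> = (\<Sum>x\<in>?V. w u x * w v x) + (a u u + a v v) * w u v"
      using uv w_commute[of v u] pair_finite_verts by (simp add: sum.distrib algebra_simps)
    finally show "(d u + d v) * w u v + (\<Sum>x\<in>?V. w u x * w v x) = 0"
      by (simp add: d_def algebra_simps)
  qed
  then show thesis by (rule that)
qed

lemma (in pair_graph) two_eigenvalue_weighting_if_q_graph_2:
  assumes "q_graph G = 2"
  obtains w d where "two_eigenvalue_weighting G w d"
proof -
  obtain A where "A \<in> sym_mats G" "card (spectrum A) = 2"
    using q_graph_attained[OF sym_mats_nonempty[OF pair_finite_verts arcs_symmetric]] assms by metis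
  moreover from this obtain l m where "spectrum A = {l, m}" by (auto simp: card_2_iff)
  ultimately show thesis using two_eigenvalue_weighting_if_sym_mats that by blast
qed

section \<open>Partial graphs of quadrangular graphs\<close>

locale quadrangular_graph = pair_graph G for G :: "'a pair_pre_digraph" +
  fixes r :: nat
  assumes regular: "u \<in> pverts G \<Longrightarrow> card {v. adj u v} = r"
    and second_common_neighbour:
      "u \<noteq> v \<Longrightarrow> \<not> adj u v \<Longrightarrow> adj u x \<Longrightarrow> adj v x \<Longrightarrow> \<exists>y. y \<noteq> x \<and> adj u y \<and> adj v y"

lemma (in two_eigenvalue_weighting) quadrangular_graph_if_regular:
  assumes "\<And>u. u \<in> pverts G \<Longrightarrow> card {v. adj u v} = r"
  shows "quadrangular_graph G r"
  by unfold_locales (use assms second_common_neighbour in metis)+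

text \<open>
  A partial graph \<open>(A, Q)\<close> on the vertices \<open>0, \<dots>, length A - 1\<close> lists for each vertex the known
  neighbours (\<open>A\<close>) and some known non-neighbours (\<open>Q\<close>). A refutation is a proof tree showing that
  it does not occur in an \<open>r\<close>-regular quadrangular graph: \<open>Common i j\<close> branches over a second common
  neighbour of the non-adjacent \<open>i, j\<close> where all neighbours of \<open>i\<close> are known; \<open>Neighbour i\<close> branches
  over a further neighbour of \<open>i\<close>, the last branch being a new vertex; \<open>Contains x m\<close> embeds an
  already refuted partial graph along \<open>m\<close>; and \<open>Record x c\<close> records the partial graph refuted by \<open>c\<close>
  under the number \<open>x\<close>.
\<close>

type_synonym partial_graph = "nat list list \<times> nat list list"

datatype refutation =
    Contains nat "nat list"
  | Common nat nat "refutation list"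
  | Neighbour nat "refutation list"
  | Record nat refutation

fun wf_partial_graph :: "partial_graph \<Rightarrow> bool" where
  "wf_partial_graph (A, Q) \<longleftrightarrow> length Q = length A \<and>
     (\<forall>i < length A. distinct (A ! i) \<and> set (A ! i) \<subseteq> {..<length A} \<and> set (Q ! i) \<subseteq> {..<length A})"

definition add_edge :: "nat \<Rightarrow> nat \<Rightarrow> nat list list \<Rightarrow> nat list list" where
  "add_edge i j A = A[i := List.insert j (A ! i), j := List.insert i (A ! j)]"

fun neighbour_cases :: "nat \<Rightarrow> nat list \<Rightarrow> partial_graph \<Rightarrow> partial_graph list" where
  "neighbour_cases i [] (A, Q) = [(add_edge i (length A) (A @ [[]]), Q @ [[]])]"
| "neighbour_cases i (j # js) (A, Q) =
     (add_edge i j A, Q) # neighbour_cases i js (A, add_edge i j Q)"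

context
  fixes r :: nat
begin

fun nonadjacent :: "partial_graph \<Rightarrow> nat \<Rightarrow> nat \<Rightarrow> bool" where
  "nonadjacent (A, Q) i j \<longleftrightarrow> j \<notin> set (A ! i) \<and>
     (j \<in> set (Q ! i) \<or> length (A ! i) = r \<or> (length (A ! j) = r \<and> i \<notin> set (A ! j)))"

definition unique_common_neighbour :: "nat list list \<Rightarrow> nat \<Rightarrow> nat \<Rightarrow> bool" where
  "unique_common_neighbour A i j \<longleftrightarrow> i < length A \<and> j < length A \<and> i \<noteq> j \<and>
     length (A ! i) = r \<and> j \<notin> set (A ! i) \<and> length (filter (\<lambda>k. k \<in> set (A ! j)) (A ! i)) = 1"

fun common_neighbour_cases :: "nat \<Rightarrow> nat \<Rightarrow> partial_graph \<Rightarrow> partial_graph list" where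
  "common_neighbour_cases i j (A, Q) = map (\<lambda>k. (add_edge k j A, Q))
     (filter (\<lambda>k. k \<notin> set (A ! j) \<and> \<not> nonadjacent (A, Q) k j) (A ! i))"

fun undecided :: "partial_graph \<Rightarrow> nat \<Rightarrow> nat list" where
  "undecided (A, Q) i =
     filter (\<lambda>j. j \<noteq> i \<and> j \<notin> set (A ! i) \<and> \<not> nonadjacent (A, Q) i j) [0..<length A]"

fun embeds :: "nat list \<Rightarrow> partial_graph \<Rightarrow> partial_graph \<Rightarrow> bool" where
  "embeds m (B, R) (A, Q) \<longleftrightarrow>
     length m = length B \<and> distinct m \<and> (\<forall>x \<in> set m. x < length A) \<and>
     (\<forall>(x, bs) \<in> set (zip m B). \<forall>j \<in> set bs. m ! j \<in> set (A ! x)) \<and>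
     (\<forall>(x, bs) \<in> set (zip m R). \<forall>j \<in> set bs. nonadjacent (A, Q) x (m ! j))"

fun refutes :: "(nat \<times> partial_graph) list \<Rightarrow> partial_graph \<Rightarrow> refutation \<Rightarrow>
    (nat \<times> partial_graph) list option"
  and refutes_all :: "(nat \<times> partial_graph) list \<Rightarrow> partial_graph list \<Rightarrow> refutation list \<Rightarrow>
    (nat \<times> partial_graph) list option" where
  "refutes K S (Contains x m) =
     (case map_of K x of None \<Rightarrow> None | Some T \<Rightarrow> if embeds m T S then Some K else None)"
| "refutes K (A, Q) (Common i j cs) =
     (if unique_common_neighbour A i j
      then refutes_all K (common_neighbour_cases i j (A, Q)) cs else None)"
| "refutes K (A, Q) (Neighbour i cs) =
     (if i < length A \<and> length (A ! i) < r
      then refutes_all K (neighbour_cases i (undecided (A, Q) i) (A, Q)) cs else None)"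
| "refutes K S (Record x c) = map_option (Cons (x, S)) (refutes K S c)"
| "refutes_all K [] [] = Some K"
| "refutes_all K (S # Ss) (c # cs) = Option.bind (refutes K S c) (\<lambda>K'. refutes_all K' Ss cs)"
| "refutes_all K _ _ = None"

end

lemma length_add_edge [simp]: "length (add_edge i j A) = length A"
  by (simp add: add_edge_def)

lemma set_add_edge_nth:
  assumes "i < length A" "j < length A" "i \<noteq> j" "k < length A"
  shows "set (add_edge i j A ! k) =
    (if k = i then insert j (set (A ! i)) else if k = j then insert i (set (A ! j))
     else set (A ! k))"
  using assms by (auto simp: add_edge_def nth_list_update)

lemma distinct_add_edge_nth:
  assumes "i < length A" "j < length A" "k < length A" "i \<noteq> j" "\<forall>k < length A. distinct (A ! k)"
  shows "distinct (add_edge i j A ! k)"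
  using assms by (auto simp: add_edge_def nth_list_update distinct_insert)

lemma wf_partial_graph_add_edge:
  assumes "wf_partial_graph (A, Q)" "i < length A" "j < length A" "i \<noteq> j"
  shows "wf_partial_graph (add_edge i j A, Q)"
  using assms by (auto simp: set_add_edge_nth distinct_add_edge_nth)

lemma wf_partial_graph_add_nonedge:
  assumes "wf_partial_graph (A, Q)" "i < length A" "j < length A" "i \<noteq> j"
  shows "wf_partial_graph (A, add_edge i j Q)"
  using assms by (auto simp: set_add_edge_nth)

lemma wf_partial_graph_add_vertex:
  assumes "wf_partial_graph (A, Q)"
  shows "wf_partial_graph (A @ [[]], Q @ [[]])"
  using assms by (auto simp: nth_append less_Suc_eq) (metis lessThan_iff subsetD)+

lemma wf_partial_graph_common_neighbour_cases:
  assumes "wf_partial_graph (A, Q)" "unique_common_neighbour r A i j"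
    "T \<in> set (common_neighbour_cases r i j (A, Q))"
  shows "wf_partial_graph T"
proof -
  from assms(3) obtain k where k: "k \<in> set (A ! i)" "T = (add_edge k j A, Q)" by auto
  then have "k < length A" "j < length A" "k \<noteq> j"
    using assms(1,2) by (auto simp: unique_common_neighbour_def)
  from wf_partial_graph_add_edge[OF assms(1) this] show ?thesis using k(2) by simp
qed

lemma wf_partial_graph_neighbour_cases:
  assumes "wf_partial_graph (A, Q)" "i < length A" "set js \<subseteq> {..<length A} - {i}"
    "T \<in> set (neighbour_cases i js (A, Q))"
  shows "wf_partial_graph T"
  using assms
proof (induction js arbitrary: Q)
  case Nil
  have "wf_partial_graph (add_edge i (length A) (A @ [[]]), Q @ [[]])"
    by (rule wf_partial_graph_add_edge[OF wf_partial_graph_add_vertex]) (use Nil in auto)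
  with Nil show ?case by simp
next
  case (Cons j js)
  then have j: "j < length A" "i \<noteq> j" by auto
  from Cons.prems consider (edge) "T = (add_edge i j A, Q)"
    | (nonedge) "T \<in> set (neighbour_cases i js (A, add_edge i j Q))" by auto
  then show ?case
  proof cases
    case edge
    then show ?thesis using wf_partial_graph_add_edge[OF Cons.prems(1,2) j] by simp
  next
    case nonedge
    show ?thesis
      by (rule Cons.IH[OF wf_partial_graph_add_nonedge[OF Cons.prems(1,2) j] _ _ nonedge])
        (use Cons.prems in auto)
  qed
qed

context quadrangular_graph
begin

lemma finite_neighbours: "finite {v. adj u v}"
  by (rule finite_subset[OF _ pair_finite_verts]) (auto dest: in_arcsD2)

fun realizes :: "(nat \<Rightarrow> 'a) \<Rightarrow> partial_graph \<Rightarrow> bool" where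
  "realizes f (A, Q) \<longleftrightarrow> inj_on f {..<length A} \<and> f ` {..<length A} \<subseteq> pverts G \<and>
     (\<forall>i < length A. (\<forall>j \<in> set (A ! i). adj (f i) (f j)) \<and> (\<forall>j \<in> set (Q ! i). \<not> adj (f i) (f j)))"

definition occurs :: "partial_graph \<Rightarrow> bool" where
  "occurs S \<longleftrightarrow> (\<exists>f. realizes f S)"

lemma neighbours_eq_if_all_known:
  assumes "realizes f (A, Q)" "wf_partial_graph (A, Q)" "i < length A" "length (A ! i) = r"
  shows "{v. adj (f i) v} = f ` set (A ! i)"
proof (rule sym, rule card_subset_eq[OF finite_neighbours])
  show "f ` set (A ! i) \<subseteq> {v. adj (f i) v}" using assms by auto
  have "inj_on f (set (A ! i))" by (rule inj_on_subset[of f "{..<length A}"]) (use assms in auto)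
  then have "card (f ` set (A ! i)) = card (set (A ! i))" by (rule card_image)
  also have "\<dots> = r" using assms distinct_card[of "A ! i"] by auto
  also have "\<dots> = card {v. adj (f i) v}" using assms by (subst regular) auto
  finally show "card (f ` set (A ! i)) = card {v. adj (f i) v}" .
qed

lemma adj_iff_if_all_known:
  assumes f: "realizes f (A, Q)" and wf: "wf_partial_graph (A, Q)"
    and i: "i < length A" "length (A ! i) = r" and j: "j < length A"
  shows "adj (f i) (f j) \<longleftrightarrow> j \<in> set (A ! i)"
proof -
  have "adj (f i) (f j) \<longleftrightarrow> f j \<in> f ` set (A ! i)"
    using neighbours_eq_if_all_known[OF f wf i] by blast
  also have "\<dots> \<longleftrightarrow> j \<in> set (A ! i)"
    using f wf i j by (intro inj_on_image_mem_iff[of f "{..<length A}"]) auto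
  finally show ?thesis .
qed

lemma not_adj_if_nonadjacent:
  assumes "realizes f (A, Q)" "wf_partial_graph (A, Q)" "i < length A" "j < length A"
    and "nonadjacent r (A, Q) i j"
  shows "\<not> adj (f i) (f j)"
proof -
  have "\<not> adj (f i) (f j)" if "j \<in> set (Q ! i)" using assms(1,3) that by simp
  then show ?thesis
    using adj_iff_if_all_known[OF assms(1,2,3) _ assms(4)]
      adj_iff_if_all_known[OF assms(1,2,4) _ assms(3)]
      arcs_symmetric[of "f i" "f j"] assms(5) by auto
qed

lemma realizes_add_edge:
  assumes "realizes f (A, Q)" "i < length A" "j < length A" "adj (f i) (f j)"
  shows "realizes f (add_edge i j A, Q)"
proof -
  have "i \<noteq> j" using assms(4) no_loops' by blast
  then show ?thesis
    using assms by (auto simp: set_add_edge_nth split: if_splits intro: arcs_symmetric)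
qed

lemma realizes_add_nonedge:
  assumes "realizes f (A, Q)" "length Q = length A" "i < length A" "j < length A" "i \<noteq> j"
    "\<not> adj (f i) (f j)"
  shows "realizes f (A, add_edge i j Q)"
  using assms by (auto simp: set_add_edge_nth split: if_splits dest: arcs_symmetric)

lemma realizes_add_vertex:
  assumes f: "realizes f (A, Q)" and wf: "wf_partial_graph (A, Q)"
    and v: "v \<in> pverts G" "v \<notin> f ` {..<length A}"
  shows "realizes (f(length A := v)) (A @ [[]], Q @ [[]])"
proof -
  let ?g = "f(length A := v)" and ?n = "length (A @ [[]])"
  have "inj_on ?g {..<?n}" using v f by (auto simp: inj_on_def less_Suc_eq)
  moreover have "?g ` {..<?n} \<subseteq> pverts G" using v f by (auto simp: less_Suc_eq)
  moreover have "adj (?g a) (?g b)" if "a < ?n" "b \<in> set ((A @ [[]]) ! a)" for a b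
    using that f wf by (fastforce simp: nth_append less_Suc_eq)
  moreover have "\<not> adj (?g a) (?g b)" if "a < ?n" "b \<in> set ((Q @ [[]]) ! a)" for a b
    using that f wf by (fastforce simp: nth_append less_Suc_eq)
  ultimately show ?thesis by auto
qed

lemma realizes_embedded:
  assumes "realizes f S" "wf_partial_graph S" "wf_partial_graph T" "embeds r m T S"
  shows "realizes (\<lambda>i. f (m ! i)) T"
proof -
  obtain A Q B R where ST: "S = (A, Q)" "T = (B, R)" by (metis surj_pair)
  note assms = assms[unfolded ST]
  let ?g = "\<lambda>i. f (m ! i)"
  have len: "length m = length B" "length R = length B" using assms by auto
  have m_less: "m ! i < length A" if "i < length B" for i
    using assms(4) that len by (auto simp: set_conv_nth)
  have "inj_on ((!) m) {..<length B}" using assms(4) len by (auto intro: inj_on_nth)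
  moreover have "(!) m ` {..<length B} \<subseteq> {..<length A}" using m_less by auto
  then have "inj_on f ((!) m ` {..<length B})" using assms(1) inj_on_subset by auto
  ultimately have "inj_on ?g {..<length B}" using comp_inj_on by (fastforce simp: comp_def)
  moreover have "?g ` {..<length B} \<subseteq> pverts G" using assms(1) m_less by auto
  moreover have "adj (?g i) (?g j)" if "i < length B" "j \<in> set (B ! i)" for i j
  proof -
    have "(m ! i, B ! i) \<in> set (zip m B)" using that len by (auto simp: set_zip)
    then have "m ! j \<in> set (A ! (m ! i))" using assms that by auto
    then show ?thesis using assms(1) m_less that by auto
  qed
  moreover have "\<not> adj (?g i) (?g j)" if "i < length B" "j \<in> set (R ! i)" for i j
  proof -
    have "(m ! i, R ! i) \<in> set (zip m R)" using that len by (auto simp: set_zip)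
    then have "nonadjacent r (A, Q) (m ! i) (m ! j)" using assms that by auto
    moreover have "j < length B" using assms that by auto
    ultimately show ?thesis using not_adj_if_nonadjacent[OF assms(1,2)] m_less that by auto
  qed
  ultimately show ?thesis using ST by auto
qed

lemma occurs_common_neighbour_case:
  assumes f: "realizes f (A, Q)" and wf: "wf_partial_graph (A, Q)"
    and unique: "unique_common_neighbour r A i j"
  shows "\<exists>T \<in> set (common_neighbour_cases r i j (A, Q)). occurs T"
proof -
  from unique have ij: "i < length A" "j < length A" "i \<noteq> j" "length (A ! i) = r"
      "j \<notin> set (A ! i)"
    by (auto simp: unique_common_neighbour_def)
  obtain k where "filter (\<lambda>k. k \<in> set (A ! j)) (A ! i) = [k]"
    using unique unfolding unique_common_neighbour_def
    by (metis One_nat_def length_0_conv length_Suc_conv)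
  then have common: "{x \<in> set (A ! i). x \<in> set (A ! j)} = {k}"
    by (metis set_filter list.set(1) list.simps(15))
  then have k: "k \<in> set (A ! i)" "k \<in> set (A ! j)" by auto
  have "f i \<noteq> f j" using f ij by (auto simp: inj_on_def)
  moreover have "\<not> adj (f i) (f j)" using adj_iff_if_all_known[OF f wf ij(1,4,2)] ij(5) by simp
  moreover have "adj (f i) (f k)" "adj (f j) (f k)" using f ij k by auto
  ultimately obtain y where y: "y \<noteq> f k" "adj (f i) y" "adj (f j) y"
    using second_common_neighbour by blast
  then obtain l where l: "l \<in> set (A ! i)" "y = f l"
    using neighbours_eq_if_all_known[OF f wf ij(1,4)] by auto
  then have l_less: "l < length A" and lj: "adj (f l) (f j)"
    using wf ij(1) y arcs_symmetric by auto
  have "l \<notin> set (A ! j)" using common l y(1) by auto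
  moreover have "\<not> nonadjacent r (A, Q) l j"
    using not_adj_if_nonadjacent[OF f wf l_less ij(2)] lj by blast
  ultimately have "(add_edge l j A, Q) \<in> set (common_neighbour_cases r i j (A, Q))"
    using l by auto
  moreover have "realizes f (add_edge l j A, Q)" by (rule realizes_add_edge[OF f l_less ij(2) lj])
  ultimately show ?thesis unfolding occurs_def by blast
qed

lemma occurs_neighbour_cases_if_neighbour:
  assumes "realizes f (A, Q)" "wf_partial_graph (A, Q)" "i < length A"
    "set js \<subseteq> {..<length A} - {i}" "adj (f i) v" "v \<in> f ` {..<length A} \<Longrightarrow> v \<in> f ` set js"
  shows "\<exists>T \<in> set (neighbour_cases i js (A, Q)). occurs T"
  using assms
proof (induction js arbitrary: Q)
  case Nil
  let ?n = "length A"
  have "realizes (f(?n := v)) (A @ [[]], Q @ [[]])"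
    by (rule realizes_add_vertex) (use Nil in_arcsD2 in auto)
  then have "realizes (f(?n := v)) (add_edge i ?n (A @ [[]]), Q @ [[]])"
    by (rule realizes_add_edge) (use Nil.prems in auto)
  then show ?case unfolding occurs_def by (auto simp del: realizes.simps)
next
  case (Cons j js)
  show ?case
  proof (cases "adj (f i) (f j)")
    case True
    have "realizes f (add_edge i j A, Q)"
      by (rule realizes_add_edge[OF Cons.prems(1)]) (use Cons.prems True in auto)
    then show ?thesis unfolding occurs_def by (auto simp del: realizes.simps)
  next
    case False
    have "realizes f (A, add_edge i j Q)"
      by (rule realizes_add_nonedge[OF Cons.prems(1)]) (use Cons.prems False in auto)
    moreover have "wf_partial_graph (A, add_edge i j Q)"
      using Cons.prems by (intro wf_partial_graph_add_nonedge) auto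
    moreover have "v \<noteq> f j" using False Cons.prems by auto
    ultimately have "\<exists>T \<in> set (neighbour_cases i js (A, add_edge i j Q)). occurs T"
      using Cons.prems by (intro Cons.IH) auto
    then show ?thesis by auto
  qed
qed

lemma occurs_neighbour_case:
  assumes f: "realizes f (A, Q)" and wf: "wf_partial_graph (A, Q)"
    and i: "i < length A" "length (A ! i) < r"
  shows "\<exists>T \<in> set (neighbour_cases i (undecided r (A, Q) i) (A, Q)). occurs T"
proof -
  have "card (f ` set (A ! i)) \<le> length (A ! i)"
    by (meson card_image_le card_length finite_set order_trans)
  then have "card (f ` set (A ! i)) < card {v. adj (f i) v}"
    using f i by (subst regular) auto
  then have "\<not> {v. adj (f i) v} \<subseteq> f ` set (A ! i)"
    by (meson card_mono finite_imageI finite_set not_le)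
  then obtain v where v: "adj (f i) v" "v \<notin> f ` set (A ! i)" by auto
  show ?thesis
  proof (rule occurs_neighbour_cases_if_neighbour[OF f wf i(1) _ v(1)])
    assume "v \<in> f ` {..<length A}"
    then obtain j where j: "j < length A" "v = f j" by auto
    moreover have "j \<noteq> i" using v j no_loops' by blast
    moreover have "\<not> nonadjacent r (A, Q) i j"
      using not_adj_if_nonadjacent[OF f wf i(1) j(1)] v j by auto
    ultimately show "v \<in> f ` set (undecided r (A, Q) i)" using v by auto
  qed auto
qed

definition refuted :: "partial_graph \<Rightarrow> bool" where
  "refuted S \<longleftrightarrow> wf_partial_graph S \<and> \<not> occurs S"

lemma refuted_if_embeds:
  "wf_partial_graph S \<Longrightarrow> refuted T \<Longrightarrow> embeds r m T S \<Longrightarrow> refuted S"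
  using realizes_embedded unfolding refuted_def occurs_def by blast

lemma refuted_if_common_neighbour_cases_refuted:
  assumes "wf_partial_graph (A, Q)" "unique_common_neighbour r A i j"
    and "\<forall>T \<in> set (common_neighbour_cases r i j (A, Q)). refuted T"
  shows "refuted (A, Q)"
  using assms occurs_common_neighbour_case unfolding refuted_def occurs_def by blast

lemma refuted_if_neighbour_cases_refuted:
  assumes "wf_partial_graph (A, Q)" "i < length A" "length (A ! i) < r"
    and "\<forall>T \<in> set (neighbour_cases i (undecided r (A, Q) i) (A, Q)). refuted T"
  shows "refuted (A, Q)"
  using assms occurs_neighbour_case unfolding refuted_def occurs_def by blast

theorem refutes_sound:
  "refutes r K S c = Some K' \<Longrightarrow> wf_partial_graph S \<Longrightarrow> list_all refuted (map snd K) \<Longrightarrow>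
     refuted S \<and> list_all refuted (map snd K')"
  "refutes_all r K Ss cs = Some K' \<Longrightarrow> list_all wf_partial_graph Ss \<Longrightarrow>
     list_all refuted (map snd K) \<Longrightarrow> list_all refuted Ss \<and> list_all refuted (map snd K')"
proof (induction K S c and K Ss cs arbitrary: K' and K' rule:
    refutes_refutes_all.induct[where r = r, case_names Contains Common Neighbour Record Nil Cons
      fewer_refutations more_refutations])
  case (Contains K S x m)
  then obtain T where T: "map_of K x = Some T" "embeds r m T S" "K' = K"
    by (auto split: option.splits if_splits)
  then have "refuted T" using Contains.prems(3) map_of_SomeD by (fastforce simp: list_all_iff)
  with T Contains.prems show ?case using refuted_if_embeds by blast
next
  case (Common K A Q i j cs)
  then have unique: "unique_common_neighbour r A i j"
    and cs: "refutes_all r K (common_neighbour_cases r i j (A, Q)) cs = Some K'"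
    by (auto split: if_splits)
  note wf = Common.prems(2)
  have "list_all wf_partial_graph (common_neighbour_cases r i j (A, Q))"
    using wf_partial_graph_common_neighbour_cases[OF wf unique] unfolding list_all_iff by blast
  from Common.IH[OF unique cs this Common.prems(3)] show ?case
    using refuted_if_common_neighbour_cases_refuted[OF wf unique] unfolding list_all_iff by blast
next
  case (Neighbour K A Q i cs)
  then have i: "i < length A" "length (A ! i) < r"
    and cs: "refutes_all r K (neighbour_cases i (undecided r (A, Q) i) (A, Q)) cs = Some K'"
    by (auto split: if_splits)
  note wf = Neighbour.prems(2)
  have "set (undecided r (A, Q) i) \<subseteq> {..<length A} - {i}" by auto
  then have "list_all wf_partial_graph (neighbour_cases i (undecided r (A, Q) i) (A, Q))"
    using wf_partial_graph_neighbour_cases[OF wf i(1)] unfolding list_all_iff by blast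
  from Neighbour.IH[OF conjI[OF i] cs this Neighbour.prems(3)] show ?case
    using refuted_if_neighbour_cases_refuted[OF wf i] unfolding list_all_iff by blast
next
  case (Record K S x c)
  then obtain K'' where "refutes r K S c = Some K''" "K' = (x, S) # K''" by auto
  with Record show ?case by simp
next
  case (Cons K S Ss c cs)
  then obtain K'' where "refutes r K S c = Some K''" "refutes_all r K'' Ss cs = Some K'"
    by (auto split: bind_splits)
  with Cons show ?case by simp
qed simp_all

end

section \<open>Isomorphisms and connectedness\<close>

lemma graph_isoI:
  assumes G: "pair_wf_digraph G" and H: "pair_wf_digraph H"
    and c: "bij_betw c I (pverts G)" and h: "bij_betw h I (pverts H)"
    and arcs: "\<And>i j. i \<in> I \<Longrightarrow> j \<in> I \<Longrightarrow> (c i, c j) \<in> parcs G \<longleftrightarrow> (h i, h j) \<in> parcs H"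
  shows "graph_iso G H"
proof -
  define g where "g = h \<circ> the_inv_into I c"
  let ?hom = "\<lparr>iso_verts = g, iso_arcs = map_prod g g, iso_head = snd, iso_tail = fst\<rparr>"
  have gc: "g (c i) = h i" if "i \<in> I" for i
    using c that by (simp add: g_def bij_betw_def the_inv_into_f_f)
  have g: "bij_betw g (pverts G) (pverts H)"
    unfolding g_def using bij_betw_the_inv_into[OF c] h by (rule bij_betw_trans)
  have G_arcs: "parcs G \<subseteq> c ` I \<times> c ` I" and H_arcs: "parcs H \<subseteq> h ` I \<times> h ` I"
    using pair_wf_digraph.wellformed'[OF G] pair_wf_digraph.wellformed'[OF H] c h
    by (auto simp: bij_betw_def)
  have inj: "inj_on (map_prod g g) (parcs G)"
    by (rule inj_on_subset[of _ "pverts G \<times> pverts G"])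
      (use g G_arcs c in \<open>auto simp: bij_betw_def intro: map_prod_inj_on\<close>)
  have img: "map_prod g g ` parcs G = parcs H"
  proof (intro equalityI subsetI)
    fix e assume "e \<in> map_prod g g ` parcs G"
    then obtain i j where "i \<in> I" "j \<in> I" "(c i, c j) \<in> parcs G" "e = (g (c i), g (c j))"
      using G_arcs by fastforce
    then show "e \<in> parcs H" using arcs gc by simp
  next
    fix e assume "e \<in> parcs H"
    moreover from this obtain i j where "i \<in> I" "j \<in> I" "e = (h i, h j)" using H_arcs by blast
    ultimately have "(c i, c j) \<in> parcs G" "e = map_prod g g (c i, c j)" using arcs gc by simp_all
    then show "e \<in> map_prod g g ` parcs G" by blast
  qed
  have "pre_digraph.digraph_isomorphism (with_proj G) ?hom"
    unfolding pre_digraph.digraph_isomorphism_def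
    using G g inj by (auto simp: wf_digraph_wp_iff bij_betw_def)
  moreover have "with_proj H = app_iso ?hom (with_proj G)"
    using g img by (simp add: app_iso_def with_proj_def bij_betw_def)
  ultimately show ?thesis unfolding digraph_iso_def by blast
qed

lemma (in pair_graph) connected_closed_under_adj:
  assumes conn: "connected (with_proj G)"
    and S: "S \<subseteq> pverts G" "S \<noteq> {}" and closed: "\<And>u v. u \<in> S \<Longrightarrow> adj u v \<Longrightarrow> v \<in> S"
  shows "S = pverts G"
proof
  obtain u where u: "u \<in> S" using S(2) by blast
  have "strongly_connected (with_proj G)"
    using symmetric_connected_imp_strongly_connected[OF sym_arcs conn] .
  show "pverts G \<subseteq> S"
  proof
    fix v assume "v \<in> pverts G"
    then have "u \<rightarrow>\<^sup>*\<^bsub>with_proj G\<^esub> v"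
      using \<open>strongly_connected _\<close> S(1) u unfolding strongly_connected_def by auto
    then show "v \<in> S" by (induction rule: reachable_induct) (use u closed in auto)
  qed
qed (rule S(1))

lemma pverts_simps:
  "pverts (undirected V E) = V"
  "pverts (complete_graph n) = {..<n}"
  "pverts (complete_bipartite_graph m n) = {..<m} <+> {..<n}"
  "pverts (circulant n D) = {..<n}"
  "pverts (cycle_graph n) = {..<n}"
  "pverts (G \<box> H) = pverts G \<times> pverts H"
  "pverts (closed_candle k) = {1..2 * k}"
  by (simp_all add: undirected_def complete_graph_def complete_bipartite_graph_def circulant_def
      cycle_graph_def cartesian_product_def closed_candle_def)

lemma parcs_simps:
  "(a, b) \<in> parcs (undirected V E) \<longleftrightarrow> (a, b) \<in> E \<or> (b, a) \<in> E"
  "(s, t) \<in> parcs (complete_graph n) \<longleftrightarrow> s < n \<and> t < n \<and> s \<noteq> t"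
  "(s, t) \<in> parcs (circulant n D) \<longleftrightarrow>
     (s < n \<and> (\<exists>d \<in> D. t = (s + d) mod n)) \<or> (t < n \<and> (\<exists>d \<in> D. s = (t + d) mod n))"
  "(s, t) \<in> parcs (cycle_graph n) \<longleftrightarrow>
     (s < n \<and> t = (s + 1) mod n) \<or> (t < n \<and> s = (t + 1) mod n)"
  "(Inl s, Inr t) \<in> parcs (complete_bipartite_graph m n) \<longleftrightarrow> s < m \<and> t < n"
  "(Inr t, Inl s) \<in> parcs (complete_bipartite_graph m n) \<longleftrightarrow> s < m \<and> t < n"
  "(Inl s, Inl t) \<notin> parcs (complete_bipartite_graph m n)"
  "(Inr s, Inr t) \<notin> parcs (complete_bipartite_graph m n)"
  "((u, v), (u', v')) \<in> parcs (G \<box> H) \<longleftrightarrow>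
     (u = u' \<and> u \<in> pverts G \<and> (v, v') \<in> parcs H) \<or> ((u, u') \<in> parcs G \<and> v = v' \<and> v \<in> pverts H)"
  by (auto simp: undirected_def complete_graph_def complete_bipartite_graph_def circulant_def
      cycle_graph_def cartesian_product_def)

lemma pair_wf_digraph_undirected: "E \<subseteq> V \<times> V \<Longrightarrow> pair_wf_digraph (undirected V E)"
  by unfold_locales (auto simp: undirected_def)

lemma pair_wf_digraph_complete_graph: "pair_wf_digraph (complete_graph n)"
  unfolding complete_graph_def by (rule pair_wf_digraph_undirected) auto

lemma pair_wf_digraph_complete_bipartite_graph: "pair_wf_digraph (complete_bipartite_graph m n)"
  unfolding complete_bipartite_graph_def by (rule pair_wf_digraph_undirected) auto

lemma pair_wf_digraph_circulant: "pair_wf_digraph (circulant n D)"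
  unfolding circulant_def by (rule pair_wf_digraph_undirected) auto

lemma pair_wf_digraph_cartesian_product:
  assumes "pair_wf_digraph G" "pair_wf_digraph H"
  shows "pair_wf_digraph (G \<box> H)"
  using assms by unfold_locales (auto simp: cartesian_product_def dest: pair_wf_digraph.wellformed')

definition adjacency_labelling :: "nat list list \<Rightarrow> (nat \<Rightarrow> 'a) \<Rightarrow> 'a pair_pre_digraph \<Rightarrow> bool" where
  "adjacency_labelling A c G \<longleftrightarrow> bij_betw c {..<length A} (pverts G) \<and>
     (\<forall>i < length A. \<forall>j < length A. (c i, c j) \<in> parcs G \<longleftrightarrow> j \<in> set (A ! i))"

definition adjacency_lists :: "'a pair_pre_digraph \<Rightarrow> 'a list \<Rightarrow> nat list list" where
  "adjacency_lists G vs =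
     map (\<lambda>u. map fst (filter (\<lambda>(j, v). (u, v) \<in> parcs G) (List.enumerate 0 vs))) vs"

lemma adjacency_labelling_adjacency_lists:
  assumes "distinct vs" "set vs = pverts G"
  shows "adjacency_labelling (adjacency_lists G vs) ((!) vs) G"
proof -
  have "(vs ! i, vs ! j) \<in> parcs G \<longleftrightarrow> j \<in> set (adjacency_lists G vs ! i)"
    if "i < length vs" "j < length vs" for i j
    using that by (force simp: adjacency_lists_def in_set_enumerate_eq)
  moreover have "length (adjacency_lists G vs) = length vs" by (simp add: adjacency_lists_def)
  ultimately show ?thesis
    using bij_betw_nth[OF assms(1) refl assms(2)[symmetric]]
    unfolding adjacency_labelling_def by simp
qed

lemma graph_iso_adjacency_lists:
  assumes G: "pair_wf_digraph G" "adjacency_labelling A c G"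
    and H: "pair_wf_digraph H" "finite (pverts H)" "card (pverts H) = length vs"
    and vs: "distinct vs" "set vs \<subseteq> pverts H" and A: "adjacency_lists H vs = A"
  shows "graph_iso G H"
proof -
  have "set vs = pverts H" using H(2,3) vs by (intro card_subset_eq) (auto simp: distinct_card)
  from adjacency_labelling_adjacency_lists[OF vs(1) this] G(2) A show ?thesis
    unfolding adjacency_labelling_def by (intro graph_isoI[OF G(1) H(1)]) auto
qed

section \<open>Closed candles\<close>

definition candle_edge :: "nat \<Rightarrow> nat \<Rightarrow> nat \<Rightarrow> bool" where
  "candle_edge k a b \<longleftrightarrow>
     odd a \<and> a + 2 \<le> 2 * k - 1 \<and> b = a + 2 \<or> a = 2 * k - 1 \<and> b = 1 \<or>
     even a \<and> 2 \<le> a \<and> a + 2 \<le> 2 * k \<and> b = a + 2 \<or> a = 2 * k \<and> b = 2 \<or>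
     1 \<le> a \<and> a \<le> 2 * k \<and> 1 \<le> b \<and> b \<le> 2 * k \<and> odd a \<and> even b \<and>
       (b = a + 3 \<or> b + 1 = a \<or> a = 2 * k - 1 \<and> b = 2 \<or> a = 1 \<and> b = 2 * k)"

lemma parcs_closed_candle_iff:
  "(a, b) \<in> parcs (closed_candle k) \<longleftrightarrow> candle_edge k a b \<or> candle_edge k b a"
proof -
  have int_diff: "int y - int x = 3 \<longleftrightarrow> y = x + 3" "int y - int x = - 1 \<longleftrightarrow> y + 1 = x" for x y :: nat
    by linarith+
  have ex_shift: "(\<exists>i. (a = i \<and> b = i + 2) \<and> P i) \<longleftrightarrow> P a \<and> b = a + 2" for a b :: nat and P
    by auto
  show ?thesis
    unfolding closed_candle_def parcs_simps candle_edge_def Un_iff mem_Collect_eq case_prod_conv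
      atLeastAtMost_iff singleton_iff prod.inject int_diff ex_shift
    by argo
qed

lemma candle_edge_iff:
  assumes "p < k" "q < k" "3 \<le> k"
  shows "candle_edge k (2 * p + 1) (2 * q + 1) \<longleftrightarrow> q = (p + 1) mod k"
    and "candle_edge k (2 * p + 2) (2 * q + 2) \<longleftrightarrow> q = (p + 1) mod k"
    and "candle_edge k (2 * p + 1) (2 * q + 2) \<longleftrightarrow> q = (p + 1) mod k \<or> p = (q + 1) mod k"
    and "\<not> candle_edge k (2 * p + 2) (2 * q + 1)"
proof -
  have successor_iff: "t = (s + 1) mod k \<longleftrightarrow> t = s + 1 \<or> s + 1 = k \<and> t = 0" if "s < k" "t < k" for s t
    using that by (auto simp: mod_if)
  show "candle_edge k (2 * p + 1) (2 * q + 1) \<longleftrightarrow> q = (p + 1) mod k"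
    "candle_edge k (2 * p + 2) (2 * q + 2) \<longleftrightarrow> q = (p + 1) mod k"
    "candle_edge k (2 * p + 1) (2 * q + 2) \<longleftrightarrow> q = (p + 1) mod k \<or> p = (q + 1) mod k"
    "\<not> candle_edge k (2 * p + 2) (2 * q + 1)"
    unfolding successor_iff[OF assms(1,2)] successor_iff[OF assms(2,1)]
    using assms by (auto simp: candle_edge_def) presburger+
qed

lemma closed_candle_eq_lexicographic_product:
  assumes "p < k" "q < k" "3 \<le> k" "a < 2" "b < 2"
  shows "(2 * p + a + 1, 2 * q + b + 1) \<in> parcs (closed_candle k) \<longleftrightarrow> (p, q) \<in> parcs (cycle_graph k)"
proof -
  consider "a = 0" "b = 0" | "a = 0" "b = 1" | "a = 1" "b = 0" | "a = 1" "b = 1"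
    using assms(4,5) by linarith
  then show ?thesis
    unfolding parcs_closed_candle_iff parcs_simps
    using assms(1,2) candle_edge_iff[OF assms(1-3)] candle_edge_iff[OF assms(2,1,3)]
    by cases (simp_all, blast+)
qed

lemma pair_wf_digraph_closed_candle:
  assumes "3 \<le> k"
  shows "pair_wf_digraph (closed_candle k)"
proof -
  have "a \<in> {1..2 * k} \<and> b \<in> {1..2 * k}" if "candle_edge k a b" for a b
    using that assms unfolding candle_edge_def by (auto simp: Suc_le_eq odd_pos)
  then show ?thesis by unfold_locales (auto simp: parcs_closed_candle_iff pverts_simps)
qed

section \<open>Chains of twins\<close>

locale quartic_quadrangular_graph = quadrangular_graph G 4 for G :: "'a pair_pre_digraph" +
  assumes connected: "Digraph_Component.connected (with_proj G)"
begin

definition twin_chain :: "(nat \<Rightarrow> 'a set) \<Rightarrow> nat \<Rightarrow> bool" where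
  "twin_chain P n \<longleftrightarrow> (\<forall>p<n. card (P p) = 2 \<and> P p \<subseteq> pverts G) \<and> disjoint_family_on P {..<n} \<and>
     (\<forall>p. Suc p < n \<longrightarrow> (\<forall>x \<in> P p. \<forall>y \<in> P (Suc p). adj x y))"

definition closed_twin_chain :: "(nat \<Rightarrow> 'a set) \<Rightarrow> nat \<Rightarrow> bool" where
  "closed_twin_chain P n \<longleftrightarrow> twin_chain P n \<and> (\<forall>x \<in> P (n - 1). \<forall>y \<in> P 0. adj x y)"

lemma twin_chain_card: "twin_chain P n \<Longrightarrow> p < n \<Longrightarrow> card (P p) = 2"
  unfolding twin_chain_def by blast

lemma twin_chain_subset_verts: "twin_chain P n \<Longrightarrow> p < n \<Longrightarrow> P p \<subseteq> pverts G"
  unfolding twin_chain_def by blast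

lemma twin_chain_finite: "twin_chain P n \<Longrightarrow> p < n \<Longrightarrow> finite (P p)"
  by (rule finite_subset[OF twin_chain_subset_verts pair_finite_verts])

lemma twin_chain_adj:
  "twin_chain P n \<Longrightarrow> q = p + 1 \<Longrightarrow> q < n \<Longrightarrow> x \<in> P p \<Longrightarrow> y \<in> P q \<Longrightarrow> adj x y"
  unfolding twin_chain_def by auto

lemma twin_chain_index_unique:
  "twin_chain P n \<Longrightarrow> p < n \<Longrightarrow> q < n \<Longrightarrow> x \<in> P p \<Longrightarrow> x \<in> P q \<Longrightarrow> p = q"
  unfolding twin_chain_def disjoint_family_on_def by blast

lemma twin_chain_rev:
  assumes P: "twin_chain P n"
  shows "twin_chain (\<lambda>p. P (n - 1 - p)) n"
proof -
  have "P (n - 1 - p) \<inter> P (n - 1 - q) = {}" if "p < n" "q < n" "p \<noteq> q" for p q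
  proof -
    have "n - 1 - p < n" "n - 1 - q < n" "n - 1 - p \<noteq> n - 1 - q" using that by auto
    then show ?thesis using twin_chain_index_unique[OF P] by blast
  qed
  then have "disjoint_family_on (\<lambda>p. P (n - 1 - p)) {..<n}" by (simp add: disjoint_family_on_def)
  moreover have "adj x y"
    if p: "Suc p < n" and xy: "x \<in> P (n - 1 - p)" "y \<in> P (n - 1 - Suc p)" for p x y
  proof -
    have "n - 1 - p = (n - 1 - Suc p) + 1" "n - 1 - p < n" using p by auto
    then show ?thesis using twin_chain_adj[OF P _ _ xy(2,1)] arcs_symmetric by blast
  qed
  ultimately show ?thesis using P unfolding twin_chain_def by auto
qed

lemma twin_chain_length:
  assumes P: "twin_chain P n"
  shows "2 * n \<le> card (pverts G)"
proof -
  have "card (\<Union>p<n. P p) = 2 * n"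
    using P twin_chain_finite[OF P] by (subst card_UN_disjoint') (auto simp: twin_chain_def)
  moreover have "(\<Union>p<n. P p) \<subseteq> pverts G" using twin_chain_subset_verts[OF P] by blast
  ultimately show ?thesis using card_mono[OF pair_finite_verts] by metis
qed

lemma adj_iff_in_two_pairs:
  assumes u: "u \<in> pverts G" and card: "card A = 2" "card B = 2" and disj: "A \<inter> B = {}"
    and adj: "\<And>v. v \<in> A \<union> B \<Longrightarrow> adj u v"
  shows "adj u v \<longleftrightarrow> v \<in> A \<union> B"
proof -
  have "finite A" "finite B" using card by (metis card.infinite zero_neq_numeral)+
  then have "card (A \<union> B) = card {v. adj u v}"
    using card disj regular[OF u] by (simp add: card_Un_disjoint)
  then have "A \<union> B = {v. adj u v}" using adj by (intro card_subset_eq finite_neighbours) auto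
  then show ?thesis by auto
qed

lemma twin_chain_inner_adj_iff:
  assumes P: "twin_chain P n" and idx: "q = p + 1" "s = p + 2" "s < n" and x: "x \<in> P q"
  shows "adj x y \<longleftrightarrow> y \<in> P p \<union> P s"
proof (rule adj_iff_in_two_pairs)
  show "x \<in> pverts G" using twin_chain_subset_verts[OF P, of q] idx x by auto
  show "card (P p) = 2" "card (P s) = 2" using twin_chain_card[OF P] idx by auto
  show "P p \<inter> P s = {}" using twin_chain_index_unique[OF P, of p s] idx by fastforce
  show "adj x v" if "v \<in> P p \<union> P s" for v
    using that twin_chain_adj[OF P, of s q x v] twin_chain_adj[OF P, of q p v x] idx x
      arcs_symmetric by auto
qed

lemma twin_chain_neighbour_of_last:
  assumes P: "twin_chain P (n + 5)" and e: "e \<in> P (n + 4)" and x: "adj e x" "x \<notin> P (n + 3)"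
    and p: "0 < p" "p < n + 4"
  shows "x \<notin> P p"
proof
  assume xp: "x \<in> P p"
  then have "e \<in> P (p - 1) \<union> P (p + 1)"
    using twin_chain_inner_adj_iff[OF P, of p "p - 1" "p + 1" x e] p x(1) arcs_symmetric by auto
  then consider "p - 1 = n + 4" | "p + 1 = n + 4"
    using twin_chain_index_unique[OF P _ _ _ e] p by fastforce
  then have "p = n + 3" using p by cases auto
  then show False using xp x(2) by simp
qed

lemma twin_chain_last_twins:
  assumes P: "twin_chain P (n + 5)" and last: "P (n + 4) = {e, f}"
    and x: "adj e x" "x \<notin> P (n + 3)" "x \<noteq> f"
  shows "adj f x"
proof -
  have e: "e \<in> P (n + 4)" using last by simp
  have fresh: "x \<notin> P (n + 1)" "x \<notin> P (n + 2)"
    using twin_chain_neighbour_of_last[OF P e x(1,2)] by auto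
  have "P (n + 3) \<noteq> {}" using twin_chain_card[OF P, of "n + 3"] by auto
  then obtain p where p: "p \<in> P (n + 3)" by auto
  then have adj_p: "adj p y \<longleftrightarrow> y \<in> P (n + 2) \<union> {e, f}" for y
    using twin_chain_inner_adj_iff[OF P, of "n + 3" "n + 2" "n + 4"] last by simp
  have "x \<noteq> e" using x(1) no_loops' by blast
  then have "\<not> adj p x" using adj_p fresh x(3) by auto
  moreover have "p \<noteq> x" using p x(2) by auto
  ultimately obtain w where w: "w \<noteq> e" "adj p w" "adj x w"
    using second_common_neighbour[of p x e] adj_p arcs_symmetric[OF x(1)] by auto
  have "w \<notin> P (n + 2)"
    using twin_chain_inner_adj_iff[OF P, of "n + 2" "n + 1" "n + 3" w x] w(3) arcs_symmetric
      fresh x(2) by auto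
  then have "w = f" using adj_p w by auto
  then show ?thesis using w(3) arcs_symmetric by simp
qed

lemma twin_chain_last_adj_prev:
  assumes "twin_chain P (n + 5)" "e \<in> P (n + 4)" "p \<in> P (n + 3)"
  shows "adj e p"
  using twin_chain_adj[OF assms(1), of "n + 4" "n + 3" p e] assms(2,3) arcs_symmetric by auto

lemma twin_chain_last_common_outer_neighbour:
  assumes P: "twin_chain P (n + 5)" and last: "P (n + 4) = {e, f}" "e \<noteq> f" and ef: "adj e f"
  obtains x where "x \<notin> P (n + 1)" "x \<notin> P (n + 2)" "x \<notin> P (n + 3)" "x \<noteq> e" "x \<noteq> f"
    and "\<And>v. adj e v \<longleftrightarrow> v \<in> P (n + 3) \<union> {f, x}" "\<And>v. adj f v \<longleftrightarrow> v \<in> P (n + 3) \<union> {e, x}"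
proof -
  have e: "e \<in> P (n + 4)" and f: "f \<in> P (n + 4)" using last by auto
  then have verts: "e \<in> pverts G" "f \<in> pverts G"
    using twin_chain_subset_verts[OF P, of "n + 4"] by auto
  have prev: "card (P (n + 3)) = 2" "finite (P (n + 3))" "e \<notin> P (n + 3)" "f \<notin> P (n + 3)"
    using twin_chain_card[OF P, of "n + 3"] twin_chain_finite[OF P, of "n + 3"]
      twin_chain_index_unique[OF P _ _ e, of "n + 3"]
      twin_chain_index_unique[OF P _ _ f, of "n + 3"] by auto
  note adj_prev = twin_chain_last_adj_prev[OF P e] twin_chain_last_adj_prev[OF P f]
  have "card (insert f (P (n + 3))) = 3" using prev by simp
  then have "\<not> {v. adj e v} \<subseteq> insert f (P (n + 3))"
    using regular[OF verts(1)] card_mono[of "insert f (P (n + 3))" "{v. adj e v}"] prev(2) by auto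
  then obtain x where x: "adj e x" "x \<noteq> f" "x \<notin> P (n + 3)" by auto
  have "adj f x" by (rule twin_chain_last_twins[OF P last(1) x(1,3,2)])
  have "x \<noteq> e" using x no_loops' by blast
  show thesis
  proof (rule that)
    show "x \<notin> P (n + 1)" "x \<notin> P (n + 2)" using twin_chain_neighbour_of_last[OF P e x(1,3)] by auto
    show "adj e v \<longleftrightarrow> v \<in> P (n + 3) \<union> {f, x}" for v
      by (rule adj_iff_in_two_pairs[OF verts(1) prev(1)]) (use x prev adj_prev ef in auto)
    show "adj f v \<longleftrightarrow> v \<in> P (n + 3) \<union> {e, x}" for v
      by (rule adj_iff_in_two_pairs[OF verts(2) prev(1)])
        (use x prev adj_prev \<open>adj f x\<close> \<open>x \<noteq> e\<close> arcs_symmetric[OF ef] in auto)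
  qed (use x \<open>x \<noteq> e\<close> in auto)
qed

lemma twin_chain_last_not_adj:
  assumes P: "twin_chain P (n + 5)" and last: "P (n + 4) = {e, f}" "e \<noteq> f"
  shows "\<not> adj e f"
proof
  assume "adj e f"
  then obtain x where x: "x \<notin> P (n + 1)" "x \<notin> P (n + 2)" "x \<notin> P (n + 3)" "x \<noteq> e" "x \<noteq> f"
    and adj_e: "\<And>v. adj e v \<longleftrightarrow> v \<in> P (n + 3) \<union> {f, x}"
    and adj_f: "\<And>v. adj f v \<longleftrightarrow> v \<in> P (n + 3) \<union> {e, x}"
    using twin_chain_last_common_outer_neighbour[OF P last] by blast
  then have "adj e x" by simp
  have "\<not> {v. adj x v} \<subseteq> {e, f}"
    using regular[of x] in_arcsD2[OF \<open>adj e x\<close>] card_mono[of "{e, f}" "{v. adj x v}"] last(2)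
    by auto
  then obtain y where y: "adj x y" "y \<noteq> e" "y \<noteq> f" by auto
  then have yx: "adj y x" and "y \<noteq> x" using arcs_symmetric no_loops' by blast+
  have "y \<notin> P (n + 3)"
    using twin_chain_inner_adj_iff[OF P, of "n + 3" "n + 2" "n + 4" y x] yx x last by auto
  then have "\<not> adj e y" "\<not> adj f y" using adj_e adj_f y \<open>y \<noteq> x\<close> by auto
  then obtain w where w: "w \<noteq> x" "adj e w" "adj y w"
    using second_common_neighbour[of e y x] \<open>adj e x\<close> y(2) yx by blast
  then have "w \<in> P (n + 3)" using adj_e \<open>\<not> adj f y\<close> arcs_symmetric by blast
  then have "y \<in> P (n + 2)"
    using twin_chain_inner_adj_iff[OF P, of "n + 3" "n + 2" "n + 4" w y] arcs_symmetric[OF w(3)]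
      last y by auto
  then show False using twin_chain_inner_adj_iff[OF P, of "n + 2" "n + 1" "n + 3" y x] yx x by auto
qed

lemma twin_chain_next_pair:
  assumes P: "twin_chain P (n + 5)"
  obtains Q where "Q \<subseteq> pverts G" "card Q = 2"
    and "\<And>x y. x \<in> P (n + 4) \<Longrightarrow> adj x y \<longleftrightarrow> y \<in> P (n + 3) \<union> Q"
    and "\<And>p. 0 < p \<Longrightarrow> p < n + 5 \<Longrightarrow> P p \<inter> Q = {}"
proof -
  obtain e f where last: "P (n + 4) = {e, f}" "e \<noteq> f"
    using twin_chain_card[OF P, of "n + 4"] by (auto simp: card_2_iff)
  then have e: "e \<in> P (n + 4)" and f: "f \<in> P (n + 4)" by auto
  have ef: "\<not> adj e f" "\<not> adj f e"
    using twin_chain_last_not_adj[OF P last] arcs_symmetric by blast+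
  have verts: "e \<in> pverts G" "f \<in> pverts G"
    using twin_chain_subset_verts[OF P, of "n + 4"] e f by auto
  have prev: "card (P (n + 3)) = 2" "finite (P (n + 3))"
    using twin_chain_card[OF P] twin_chain_finite[OF P] by auto
  note adj_prev = twin_chain_last_adj_prev[OF P e] twin_chain_last_adj_prev[OF P f]
  define Q where "Q = {v. adj e v} - P (n + 3)"
  have card: "card Q = 2"
    using card_Diff_subset[OF prev(2), of "{v. adj e v}"] adj_prev regular[OF verts(1)] prev(1)
    unfolding Q_def by auto
  have adj_f: "adj f x" if "x \<in> Q" for x
    using that ef twin_chain_last_twins[OF P last(1), of x] unfolding Q_def by auto
  show thesis
  proof (rule that)
    show "Q \<subseteq> pverts G" unfolding Q_def using in_arcsD2 by auto
    show "card Q = 2" by (rule card)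
    have "adj f v \<longleftrightarrow> v \<in> P (n + 3) \<union> Q" for v
      by (rule adj_iff_in_two_pairs[OF verts(2) prev(1) card])
        (use adj_prev adj_f in \<open>auto simp: Q_def\<close>)
    moreover have "adj e v \<longleftrightarrow> v \<in> P (n + 3) \<union> Q" for v using adj_prev unfolding Q_def by auto
    ultimately show "adj x v \<longleftrightarrow> v \<in> P (n + 3) \<union> Q" if "x \<in> P (n + 4)" for x v
      using that unfolding last(1) by blast
    show "P p \<inter> Q = {}" if "0 < p" "p < n + 5" for p
      using twin_chain_neighbour_of_last[OF P, of e _ p] that last ef no_loops' unfolding Q_def
      by (cases "p = n + 4") auto
  qed
qed

lemma twin_chain_extend:
  assumes P: "twin_chain P (Suc m)" and Q: "Q \<subseteq> pverts G" "card Q = 2"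
    and adj: "\<And>x y. x \<in> P m \<Longrightarrow> y \<in> Q \<Longrightarrow> adj x y" and disj: "\<And>p. p < Suc m \<Longrightarrow> P p \<inter> Q = {}"
  shows "twin_chain (P(Suc m := Q)) (Suc (Suc m))"
proof -
  let ?P = "P(Suc m := Q)"
  have "card (?P p) = 2 \<and> ?P p \<subseteq> pverts G" if "p < Suc (Suc m)" for p
    using P Q that unfolding twin_chain_def by (auto simp: less_Suc_eq)
  moreover have "?P p \<inter> ?P q = {}" if "p < Suc (Suc m)" "q < Suc (Suc m)" "p \<noteq> q" for p q
    using that disj[of p] disj[of q] twin_chain_index_unique[OF P, of p q]
    by (cases "p = Suc m"; cases "q = Suc m") auto
  then have "disjoint_family_on ?P {..<Suc (Suc m)}" by (simp add: disjoint_family_on_def)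
  moreover have "adj x y" if "Suc p < Suc (Suc m)" "x \<in> ?P p" "y \<in> ?P (Suc p)" for p x y
    using that adj twin_chain_adj[OF P, of "Suc p" p x y] by (auto split: if_splits)
  ultimately show ?thesis unfolding twin_chain_def by blast
qed

lemma twin_chain_extends_or_closes:
  assumes P: "twin_chain P (n + 5)"
  shows "closed_twin_chain P (n + 5) \<or> (\<exists>Q. twin_chain (P(n + 5 := Q)) (n + 6))"
proof -
  obtain Q where Q: "Q \<subseteq> pverts G" "card Q = 2"
    and adj: "\<And>x y. x \<in> P (n + 4) \<Longrightarrow> adj x y \<longleftrightarrow> y \<in> P (n + 3) \<union> Q"
    and disj: "\<And>p. 0 < p \<Longrightarrow> p < n + 5 \<Longrightarrow> P p \<inter> Q = {}"
    by (rule twin_chain_next_pair[OF P]) blast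
  show ?thesis
  proof (cases "P 0 \<inter> Q = {}")
    case True
    then have "P p \<inter> Q = {}" if "p < Suc (n + 4)" for p
      using disj[of p] that by (cases "p = 0") auto
    then have "twin_chain (P(Suc (n + 4) := Q)) (Suc (Suc (n + 4)))"
      using P Q adj by (intro twin_chain_extend) (auto simp: numeral_eq_Suc)
    then show ?thesis by (auto simp: numeral_eq_Suc)
  next
    case False
    then obtain v where v: "v \<in> P 0" "v \<in> Q" by blast
    have rev: "twin_chain (\<lambda>p. P (n + 4 - p)) (n + 5)"
      using twin_chain_rev[OF P] by (simp add: add.commute)
    have "adj e x" if e: "e \<in> P (n + 4)" and x: "x \<in> P 0" for e x
    proof (cases "x = v")
      case False
      then have "P 0 = {v, x}"
        using twin_chain_card[OF P, of 0] v(1) x by (auto simp: card_2_iff doubleton_eq_iff)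
      moreover have "adj v e" using adj[OF e] v(2) arcs_symmetric by blast
      moreover have "e \<notin> P 1" "e \<noteq> x"
        using twin_chain_index_unique[OF P _ _ e, of 1] twin_chain_index_unique[OF P _ _ e, of 0] x
        by auto
      ultimately have "adj x e" using twin_chain_last_twins[OF rev, of v x e] by simp
      then show ?thesis by (rule arcs_symmetric)
    qed (use adj[OF e] v(2) in blast)
    then show ?thesis using P unfolding closed_twin_chain_def by (simp add: add.commute)
  qed
qed

lemma twin_chain_closes:
  assumes "twin_chain P (n + 5)"
  obtains P' n' where "closed_twin_chain P' (n' + 5)"
  using assms
proof (induction "card (pverts G) - n" arbitrary: P n thesis rule: less_induct)
  case less
  consider (closes) "closed_twin_chain P (n + 5)"
    | (extends) Q where "twin_chain (P(n + 5 := Q)) (n + 6)"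
    using twin_chain_extends_or_closes[OF less.prems(2)] by blast
  then show ?case
  proof cases
    case closes
    then show ?thesis by (rule less.prems(1))
  next
    case extends
    then have "twin_chain (P(n + 5 := Q)) (Suc n + 5)" by (simp add: add.commute)
    moreover from twin_chain_length[OF this]
    have "card (pverts G) - Suc n < card (pverts G) - n" by simp
    ultimately show ?thesis using less.hyps less.prems(1) by blast
  qed
qed

lemma closed_twin_chain_adj_if_cycle_arc:
  assumes P: "closed_twin_chain P n" and pq: "(p, q) \<in> parcs (cycle_graph n)"
    and xy: "x \<in> P p" "y \<in> P q"
  shows "adj x y"
proof -
  have step: "adj x y" if "p < n" "x \<in> P p" "y \<in> P ((p + 1) mod n)" for p x y
  proof (cases "Suc p < n")
    case True
    then show ?thesis
      using P that twin_chain_adj[of P n "Suc p"] unfolding closed_twin_chain_def by auto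
  next
    case False
    then have "p = n - 1" "Suc p = n" using that by auto
    then show ?thesis using P that unfolding closed_twin_chain_def by simp
  qed
  from pq consider "p < n" "q = (p + 1) mod n" | "q < n" "p = (q + 1) mod n"
    by (auto simp: parcs_simps)
  then show ?thesis using step xy arcs_symmetric by cases blast+
qed

lemma closed_twin_chain_adj_iff:
  assumes P: "closed_twin_chain P n" and n: "3 \<le> n" and p: "p < n" and x: "x \<in> P p"
  shows "adj x y \<longleftrightarrow> (\<exists>q. (p, q) \<in> parcs (cycle_graph n) \<and> y \<in> P q)"
proof -
  have chain: "twin_chain P n" using P unfolding closed_twin_chain_def by blast
  let ?s = "(p + 1) mod n" and ?t = "(p + (n - 1)) mod n"
  have less: "?s < n" "?t < n" using n by simp_all
  have t_iff: "?t = (if p = 0 then n - 1 else p - 1)" using n p by (auto simp: mod_if)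
  then have arcs: "(p, ?s) \<in> parcs (cycle_graph n)" "(p, ?t) \<in> parcs (cycle_graph n)"
    using n p by (auto simp: parcs_simps mod_if)
  have "?s \<noteq> ?t" using n p unfolding t_iff by (auto simp: mod_if)
  then have "P ?s \<inter> P ?t = {}" using twin_chain_index_unique[OF chain less] by blast
  then have "adj x y \<longleftrightarrow> y \<in> P ?s \<union> P ?t"
    using twin_chain_subset_verts[OF chain p] twin_chain_card[OF chain] less x arcs
      closed_twin_chain_adj_if_cycle_arc[OF P _ x]
    by (intro adj_iff_in_two_pairs) auto
  then show ?thesis using closed_twin_chain_adj_if_cycle_arc[OF P _ x] arcs by blast
qed

lemma closed_twin_chain_covers:
  assumes P: "closed_twin_chain P n" and n: "3 \<le> n"
  shows "(\<Union>p<n. P p) = pverts G"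
proof (rule connected_closed_under_adj[OF connected])
  have chain: "twin_chain P n" using P unfolding closed_twin_chain_def by blast
  show "(\<Union>p<n. P p) \<subseteq> pverts G" using twin_chain_subset_verts[OF chain] by blast
  have "P 0 \<noteq> {}" using twin_chain_card[OF chain, of 0] n by auto
  then show "(\<Union>p<n. P p) \<noteq> {}" using n by force
  fix u v assume "u \<in> (\<Union>p<n. P p)" "adj u v"
  then obtain p q where "(p, q) \<in> parcs (cycle_graph n)" "v \<in> P q"
    using closed_twin_chain_adj_iff[OF P n] by blast
  moreover from this have "q < n" using n by (auto simp: parcs_simps)
  ultimately show "v \<in> (\<Union>p<n. P p)" by blast
qed

lemma closed_twin_chain_labelling:
  assumes P: "closed_twin_chain P n" and n: "3 \<le> n"
  obtains c where "bij_betw (\<lambda>(p, a). c p a) ({..<n} \<times> {..<2 :: nat}) (pverts G)"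
    and "\<And>p a. p < n \<Longrightarrow> a < 2 \<Longrightarrow> c p a \<in> P p"
proof -
  have chain: "twin_chain P n" using P unfolding closed_twin_chain_def by blast
  have "\<exists>c. bij_betw c {..<2 :: nat} (P p)" if "p < n" for p
    using twin_chain_card[OF chain that] ex_bij_betw_nat_finite[of "P p"]
    by (metis atLeast0LessThan card.infinite zero_neq_numeral)
  then obtain c :: "nat \<Rightarrow> nat \<Rightarrow> 'a" where c: "\<And>p. p < n \<Longrightarrow> bij_betw (c p) {..<2} (P p)" by metis
  then have mem: "c p a \<in> P p" if "p < n" "a < 2" for p a using bij_betwE[OF c] that by auto
  let ?c = "\<lambda>(p, a). c p a" and ?I = "{..<n} \<times> {..<2 :: nat}"
  have "inj_on ?c ?I"
  proof (rule inj_onI, clarify)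
    fix p a q b assume *: "p < n" "q < n" "a < (2 :: nat)" "b < (2 :: nat)" "c p a = c q b"
    then have "p = q" using twin_chain_index_unique[OF chain] mem by metis
    with * show "p = q \<and> a = b" using c[of q] by (auto simp: bij_betw_def inj_on_def)
  qed
  moreover have "?c ` ?I = (\<Union>p<n. c p ` {..<2})" by auto
  then have "?c ` ?I = pverts G"
    using c closed_twin_chain_covers[OF P n] by (simp add: bij_betw_def)
  ultimately show thesis using that mem unfolding bij_betw_def by blast
qed

theorem graph_iso_closed_candle_if_closed_twin_chain:
  assumes P: "closed_twin_chain P n" and n: "3 \<le> n"
  shows "graph_iso G (closed_candle n)"
proof -
  obtain c where c: "bij_betw (\<lambda>(p, a). c p a) ({..<n} \<times> {..<2 :: nat}) (pverts G)"
    and mem: "\<And>p a. p < n \<Longrightarrow> a < 2 \<Longrightarrow> c p a \<in> P p"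
    by (rule closed_twin_chain_labelling[OF P n]) blast
  let ?h = "\<lambda>(p, a). 2 * p + a + 1 :: nat"
  have h: "bij_betw ?h ({..<n} \<times> {..<2}) (pverts (closed_candle n))"
    unfolding pverts_simps
    by (rule bij_betw_byWitness[where f' = "\<lambda>i. ((i - 1) div 2, (i - 1) mod 2)"]) auto
  have "adj (c p a) (c q b) \<longleftrightarrow> (2 * p + a + 1, 2 * q + b + 1) \<in> parcs (closed_candle n)"
    if "p < n" "q < n" "a < 2" "b < 2" for p q a b
  proof -
    have "twin_chain P n" using P unfolding closed_twin_chain_def by blast
    then have "c q b \<in> P t \<longleftrightarrow> t = q" if "t < n" for t
      using twin_chain_index_unique[of P n t q] mem \<open>q < n\<close> \<open>b < 2\<close> that by blast
    moreover have "t < n" if "(p, t) \<in> parcs (cycle_graph n)" for t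
      using that n by (auto simp: parcs_simps)
    ultimately have "adj (c p a) (c q b) \<longleftrightarrow> (p, q) \<in> parcs (cycle_graph n)"
      using closed_twin_chain_adj_iff[OF P n \<open>p < n\<close> mem] that by blast
    then show ?thesis using closed_candle_eq_lexicographic_product n that by simp
  qed
  then show ?thesis
    by (intro graph_isoI[OF pair_wf_digraph pair_wf_digraph_closed_candle[OF n] c h]) auto
qed

end

section \<open>The search\<close>

definition K5_adj :: "nat list list" where
  "K5_adj =
     [[1, 2, 3, 4], [0, 2, 3, 4], [0, 1, 3, 4], [0, 1, 2, 4], [0, 1, 2, 3]]"

definition R_7_1_adj :: "nat list list" where
  "R_7_1_adj =
     [[1, 2, 3, 4], [0, 2, 3, 5], [0, 1, 4, 6], [0, 1, 5, 6], [0, 2, 5, 6], [1, 3, 4, 6],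
      [2, 3, 4, 5]]"

definition R_8_2_adj :: "nat list list" where
  "R_8_2_adj =
     [[1, 2, 3, 4], [0, 2, 3, 5], [0, 1, 6, 7], [0, 1, 6, 7], [0, 5, 6, 7], [1, 4, 6, 7],
      [2, 3, 4, 5], [2, 3, 4, 5]]"

definition R_8_3_adj :: "nat list list" where
  "R_8_3_adj =
     [[1, 2, 3, 4], [0, 2, 3, 5], [0, 1, 4, 6], [0, 1, 6, 7], [0, 2, 5, 7], [1, 4, 6, 7],
      [2, 3, 5, 7], [3, 4, 5, 6]]"

definition R_8_4_adj :: "nat list list" where
  "R_8_4_adj =
     [[1, 2, 3, 4], [0, 2, 3, 4], [0, 1, 5, 6], [0, 1, 5, 7], [0, 1, 6, 7], [2, 3, 6, 7],
      [2, 4, 5, 7], [3, 4, 5, 6]]"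

definition R_8_5_adj :: "nat list list" where
  "R_8_5_adj =
     [[1, 2, 3, 4], [0, 2, 3, 5], [0, 1, 3, 6], [0, 1, 2, 7], [0, 5, 6, 7], [1, 4, 6, 7],
      [2, 4, 5, 7], [3, 4, 5, 6]]"

definition R_8_6_adj :: "nat list list" where
  "R_8_6_adj =
     [[1, 2, 3, 4], [0, 2, 3, 5], [0, 1, 4, 6], [0, 1, 5, 7], [0, 2, 6, 7], [1, 3, 6, 7],
      [2, 4, 5, 7], [3, 4, 5, 6]]"

definition K3_C4_adj :: "nat list list" where
  "K3_C4_adj =
     [[1, 2, 3, 4], [0, 2, 5, 6], [0, 1, 7, 8], [0, 5, 7, 9], [0, 6, 8, 9], [1, 3, 7, 10],
      [1, 4, 8, 10], [2, 3, 5, 11], [2, 4, 6, 11], [3, 4, 10, 11], [5, 6, 9, 11],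
      [7, 8, 9, 10]]"

definition K33_K2_adj :: "nat list list" where
  "K33_K2_adj =
     [[1, 2, 3, 4], [0, 5, 6, 7], [0, 5, 6, 8], [0, 5, 6, 9], [0, 7, 8, 9], [1, 2, 3, 10],
      [1, 2, 3, 11], [1, 4, 10, 11], [2, 4, 10, 11], [3, 4, 10, 11], [5, 7, 8, 9],
      [6, 7, 8, 9]]"

definition R_10_2_adj :: "nat list list" where
  "R_10_2_adj =
     [[1, 2, 3, 4], [0, 2, 5, 6], [0, 1, 7, 8], [0, 4, 5, 7], [0, 3, 6, 8], [1, 3, 8, 9],
      [1, 4, 7, 9], [2, 3, 6, 9], [2, 4, 5, 9], [5, 6, 7, 8]]"

definition R_10_3_adj :: "nat list list" where
  "R_10_3_adj =
     [[1, 2, 3, 4], [0, 2, 3, 4], [0, 1, 5, 6], [0, 1, 5, 7], [0, 1, 6, 7], [2, 3, 8, 9],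
      [2, 4, 8, 9], [3, 4, 8, 9], [5, 6, 7, 9], [5, 6, 7, 8]]"

definition R_10_4_adj :: "nat list list" where
  "R_10_4_adj =
     [[1, 2, 3, 4], [0, 5, 6, 7], [0, 5, 6, 8], [0, 5, 7, 8], [0, 6, 7, 8], [1, 2, 3, 9],
      [1, 2, 4, 9], [1, 3, 4, 9], [2, 3, 4, 9], [5, 6, 7, 8]]"

definition R_12_3_adj :: "nat list list" where
  "R_12_3_adj =
     [[1, 2, 3, 4], [0, 5, 6, 7], [0, 5, 6, 8], [0, 5, 7, 9], [0, 6, 8, 9], [1, 2, 3, 10],
      [1, 2, 4, 11], [1, 3, 10, 11], [2, 4, 10, 11], [3, 4, 10, 11], [5, 7, 8, 9],
      [6, 7, 8, 9]]"

definition R_14_1_adj :: "nat list list" where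
  "R_14_1_adj =
     [[1, 2, 3, 4], [0, 5, 6, 7], [0, 5, 8, 9], [0, 6, 8, 10], [0, 7, 9, 10], [1, 2, 11, 12],
      [1, 3, 11, 13], [1, 4, 12, 13], [2, 3, 12, 13], [2, 4, 11, 13], [3, 4, 11, 12],
      [5, 6, 9, 10], [5, 7, 8, 10], [6, 7, 8, 9]]"

definition Q4_adj :: "nat list list" where
  "Q4_adj =
     [[1, 2, 3, 4], [0, 5, 6, 7], [0, 5, 8, 9], [0, 6, 8, 10], [0, 7, 9, 10], [1, 2, 11, 12],
      [1, 3, 11, 13], [1, 4, 12, 13], [2, 3, 11, 14], [2, 4, 12, 14], [3, 4, 13, 14],
      [5, 6, 8, 15], [5, 7, 9, 15], [6, 7, 10, 15], [8, 9, 10, 15], [11, 12, 13, 14]]"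

definition H3_adj :: "nat list list" where
  "H3_adj =
     [[1, 2, 3, 4], [0, 2, 3, 5], [0, 1, 4, 5], [0, 1, 4, 5], [0, 2, 3, 5], [1, 2, 3, 4]]"

definition H4_adj :: "nat list list" where
  "H4_adj =
     [[1, 2, 3, 4], [0, 5, 6, 7], [0, 5, 6, 7], [0, 5, 6, 7], [0, 5, 6, 7], [1, 2, 3, 4],
      [1, 2, 3, 4], [1, 2, 3, 4]]"

definition H5_adj :: "nat list list" where
  "H5_adj =
     [[1, 2, 3, 4], [0, 5, 6, 7], [0, 5, 6, 7], [0, 5, 8, 9], [0, 5, 8, 9], [1, 2, 3, 4],
      [1, 2, 8, 9], [1, 2, 8, 9], [3, 4, 6, 7], [3, 4, 6, 7]]"

definition S_7_adj :: "nat list list" where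
  "S_7_adj =
     [[1, 2, 3, 4], [0, 2, 3, 4], [0, 1, 5, 6], [0, 1, 5, 6], [0, 1, 5, 6], [2, 3, 4, 6],
      [2, 3, 4, 5]]"

definition K3_K3_adj :: "nat list list" where
  "K3_K3_adj =
     [[1, 2, 3, 4], [0, 2, 5, 6], [0, 1, 7, 8], [0, 4, 5, 7], [0, 3, 6, 8], [1, 3, 6, 7],
      [1, 4, 5, 8], [2, 3, 5, 8], [2, 4, 6, 7]]"

definition S_9_2_adj :: "nat list list" where
  "S_9_2_adj =
     [[1, 2, 3, 4], [0, 2, 5, 6], [0, 1, 7, 8], [0, 4, 5, 7], [0, 3, 6, 8], [1, 3, 6, 8],
      [1, 4, 5, 7], [2, 3, 6, 8], [2, 4, 5, 7]]"

definition S_9_3_adj :: "nat list list" where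
  "S_9_3_adj =
     [[1, 2, 3, 4], [0, 2, 5, 6], [0, 1, 7, 8], [0, 5, 6, 7], [0, 5, 7, 8], [1, 3, 4, 8],
      [1, 3, 7, 8], [2, 3, 4, 6], [2, 4, 5, 6]]"

definition S_12_adj :: "nat list list" where
  "S_12_adj =
     [[1, 2, 3, 4], [0, 5, 6, 7], [0, 5, 6, 7], [0, 5, 8, 9], [0, 6, 8, 9], [1, 2, 3, 10],
      [1, 2, 4, 11], [1, 2, 10, 11], [3, 4, 10, 11], [3, 4, 10, 11], [5, 7, 8, 9],
      [6, 7, 8, 9]]"

definition twin_chain_5_adj :: "nat list list" where
  "twin_chain_5_adj =
     [[2, 3], [2, 3], [0, 1, 4, 5], [0, 1, 4, 5], [2, 3, 6, 7], [2, 3, 6, 7], [4, 5, 8, 9],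
      [4, 5, 8, 9], [6, 7], [6, 7]]"

definition catalogue :: "nat list list list" where
  "catalogue = [K5_adj, R_7_1_adj, R_8_2_adj, R_8_3_adj, R_8_4_adj, R_8_5_adj, R_8_6_adj, K3_C4_adj,
     K33_K2_adj, R_10_2_adj, R_10_3_adj, R_10_4_adj, R_12_3_adj, R_14_1_adj, Q4_adj, H3_adj, H4_adj,
     H5_adj]"

text \<open>
  Quartic quadrangular graphs for which no matrix has exactly two distinct eigenvalues.
\<close>

definition spurious :: "nat list list list" where
  "spurious = [S_7_adj, K3_K3_adj, S_9_2_adj, S_9_3_adj, S_12_adj]"

definition edges_only :: "nat list list \<Rightarrow> partial_graph" where
  "edges_only A = (A, map (\<lambda>_. []) A)"

definition outcomes :: "(nat \<times> partial_graph) list" where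
  "outcomes = List.enumerate 0 (map edges_only (catalogue @ spurious @ [twin_chain_5_adj]))"

text \<open>
  \<open>K\<^sub>4\<close>, \<open>K\<^sub>4\<close> minus an edge, a triangle, \<open>K\<^sub>2\<^sub>,\<^sub>4\<close>, \<open>K\<^sub>2\<^sub>,\<^sub>3\<close> and a single vertex, to be refuted in
  this order.
\<close>

definition seeds :: "nat list list list" where
  "seeds = [
     [[3, 2, 1], [3, 2, 0], [3, 1, 0], [2, 1, 0]],
     [[3, 2, 1], [3, 2, 0], [1, 0], [1, 0]],
     [[2, 1], [2, 0], [1, 0]],
     [[5, 4, 3, 2], [5, 4, 3, 2], [1, 0], [1, 0], [1, 0], [1, 0]],
     [[4, 3, 2], [4, 3, 2], [1, 0], [1, 0], [1, 0]],
     [[]]]"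

text \<open>
  Found by a computer search that always branches where the fewest non-trivial cases arise. The
  numbers up to 23 refer to \<open>outcomes\<close>.
\<close>

definition refutations :: "refutation list" where
  "refutations = [
     Record 31 (Neighbour 0 [Neighbour 1 [Record 29 (Neighbour 2 [Neighbour 3 [Contains 0 [0, 1,
     2, 3, 4], Record 24 (Common 0 5 [Neighbour 5 [Common 3 6 []]])], Record 28 (Common 0 5
     [Record 26 (Neighbour 4 [Contains 24 [0, 1, 3, 2, 4, 5], Common 0 6 [Record 25 (Common 2 6
     [Neighbour 5 [Common 2 7 []]])]]), Record 27 (Neighbour 4 [Contains 26 [0, 1, 2, 3, 4, 5],
     Common 0 6 []])])]), Common 0 5 [Neighbour 2 [Contains 26 [0, 2, 1, 3, 4, 5], Contains 26 [1,
     2, 0, 3, 5, 4], Common 0 6 [Common 1 6 [Neighbour 4 [Contains 25 [0, 3, 1, 2, 4, 5, 6],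
     Common 0 7 [Record 30 (Common 1 7 [Common 2 7 [Contains 5 [0, 1, 2, 3, 4, 5, 6, 7]]])]],
     Contains 26 [2, 3, 0, 1, 6, 4]], Contains 28 [2, 3, 0, 1, 6, 4]]], Contains 28 [1, 3, 0, 2,
     5, 4], Contains 28 [1, 2, 0, 3, 5, 4]]]]),
     Record 53 (Neighbour 0 [Record 52 (Neighbour 1 [Record 36 (Neighbour 2 [Contains 29 [0, 1, 2,
     3, 4], Contains 29 [0, 1, 2, 4, 3], Neighbour 2 [Common 0 5 [Record 35 (Common 0 6 [Neighbour
     3 [Record 32 (Neighbour 3 [Neighbour 5 [Contains 18 [0, 1, 2, 3, 4, 5, 6], Common 2 7
     [Neighbour 7 [Common 5 8 []]]], Common 0 7 []]), Contains 32 [0, 1, 2, 3, 4, 6, 5], Common 0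
     7 []], Neighbour 3 [Contains 25 [0, 1, 3, 4, 2, 6, 5], Contains 32 [0, 1, 2, 4, 3, 5, 6],
     Common 0 7 [Neighbour 5 [Record 33 (Common 3 5 [Common 2 7 [Contains 4 [0, 1, 2, 3, 4, 6, 5,
     7]]]), Common 3 5 [], Common 2 8 [Common 3 8 [Neighbour 5 [Common 2 9 [Common 3 9 [Record 34
     (Neighbour 8 [Contains 10 [0, 1, 2, 3, 4, 6, 5, 7, 8, 9], Common 5 10 [Neighbour 10 [Common 8
     11 []]]])]]]]]]]]]), Contains 35 [0, 1, 2, 4, 3, 5, 6]]]]), Record 51 (Common 0 5 [Neighbour
     4 [Record 42 (Neighbour 4 [Neighbour 2 [Contains 24 [0, 2, 3, 1, 4, 5], Neighbour 3 [Contains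
     15 [0, 1, 2, 3, 4, 5], Common 0 6 []], Common 0 6 [Neighbour 5 [Neighbour 5 [Common 1 7 []],
     Common 1 7 []]]], Common 0 6 [Common 1 6 [Record 38 (Neighbour 6 [Record 37 (Neighbour 3
     [Contains 1 [0, 1, 2, 3, 4, 5, 6], Common 0 7 []]), Common 6 2 [Common 0 7 [Neighbour 5
     [Contains 3 [0, 1, 2, 3, 4, 5, 7, 6], Common 1 8 []]], Common 4 7 [], Contains 25 [0, 2, 1,
     3, 4, 5, 6]]]), Record 39 (Neighbour 3 [Contains 37 [1, 3, 0, 5, 2, 6, 4], Common 0 7 []])],
     Record 41 (Common 1 6 [Record 40 (Common 4 3 [Contains 37 [0, 1, 2, 3, 4, 5, 6], Contains 38
     [1, 0, 3, 2, 5, 4, 6]]), Contains 39 [0, 1, 2, 3, 4, 5, 6]])]]), Contains 42 [0, 1, 3, 2, 4,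
     5], Neighbour 4 [Common 0 6 [Record 49 (Common 0 7 [Common 1 6 [Record 45 (Common 1 7 [Common
     4 2 [Record 43 (Neighbour 2 [Contains 2 [0, 1, 2, 3, 4, 5, 6, 7], Common 0 8 []]), Contains
     43 [0, 1, 2, 3, 4, 5, 7, 6]], Record 44 (Neighbour 2 [Contains 38 [1, 0, 2, 3, 5, 4, 6],
     Neighbour 5 [Contains 43 [0, 1, 3, 2, 4, 5, 7, 6], Common 1 8 []], Common 0 8 []])]), Record
     46 (Common 3 5 [Contains 44 [0, 1, 2, 3, 4, 5, 7, 6], Contains 45 [0, 1, 2, 3, 4, 5, 6,
     7]])], Record 48 (Common 1 6 [Record 47 (Common 1 7 [Neighbour 2 [Contains 30 [0, 1, 2, 3, 4,
     5, 7, 6], Contains 43 [0, 1, 3, 2, 4, 5, 7, 6], Common 0 8 [Neighbour 6 [Contains 30 [4, 5,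
     6, 7, 0, 1, 3, 2], Common 2 6 [], Common 3 9 [Neighbour 8 [Common 2 9 [], Common 3 10
     []]]]]], Contains 44 [0, 1, 2, 3, 4, 5, 6, 7]]), Contains 46 [0, 1, 3, 2, 4, 5, 6, 7]])]),
     Contains 49 [0, 1, 3, 2, 4, 5, 6, 7]]]], Record 50 (Common 1 4 [Contains 42 [1, 0, 3, 2, 5,
     4], Neighbour 2 [Contains 42 [1, 3, 0, 5, 2, 4], Contains 42 [0, 3, 1, 4, 2, 5], Common 0 6
     [Common 1 6 [Neighbour 2 [Common 0 7 [Common 1 7 [Neighbour 6 [Contains 33 [6, 7, 2, 4, 5, 1,
     0, 3], Common 2 8 [Neighbour 8 [Common 6 9 []]]]]]]]]], Neighbour 2 [Contains 27 [0, 2, 1, 3,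
     4, 5], Contains 42 [0, 2, 1, 4, 3, 5], Common 0 6 [Common 1 6 [Neighbour 5 [Contains 38 [1,
     0, 3, 2, 5, 4, 6], Common 1 7 [Common 0 7 [Common 2 7 [Contains 6 [0, 1, 2, 3, 4, 5, 6,
     7]]]]], Contains 40 [1, 3, 0, 5, 2, 6, 4]], Contains 41 [0, 2, 1, 4, 3, 6, 5]]]]), Contains
     50 [0, 1, 3, 2, 4, 5]])])]),
     Record 66 (Neighbour 0 [Neighbour 0 [Record 65 (Neighbour 1 [Contains 52 [0, 1, 2, 3, 4],
     Contains 52 [0, 1, 2, 4, 3], Neighbour 1 [Record 64 (Neighbour 2 [Contains 52 [0, 2, 1, 3,
     4], Contains 52 [0, 2, 1, 4, 3], Contains 52 [1, 2, 0, 5, 6], Contains 52 [1, 2, 0, 6, 5],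
     Neighbour 2 [Common 0 5 [Record 63 (Common 0 6 [Common 0 7 [Common 0 8 [Record 58 (Common 1 3
     [Record 57 (Common 1 7 [Record 55 (Common 1 8 [Common 4 8 [Record 54 (Neighbour 3 [Contains
     20 [2, 8, 7, 0, 1, 3, 5, 4, 6], Common 0 9 []])]]), Common 2 6 [Record 56 (Neighbour 3
     [Contains 55 [0, 1, 2, 4, 3, 5, 6, 8, 7], Common 3 5 [Contains 21 [0, 1, 2, 4, 3, 6, 5, 7,
     8]], Common 0 9 []]), Contains 45 [4, 7, 5, 6, 0, 2, 1, 3]]]), Contains 57 [0, 1, 2, 3, 4, 6,
     5, 7, 8]])], Common 0 8 [Contains 58 [0, 1, 2, 3, 4, 5, 6, 8, 7], Common 1 3 [Contains 58 [0,
     2, 1, 4, 3, 8, 7, 6, 5], Contains 58 [0, 2, 1, 4, 3, 8, 7, 5, 6]]]], Common 0 7 [Record 62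
     (Common 0 8 [Contains 58 [0, 2, 1, 3, 4, 8, 7, 5, 6], Record 61 (Common 1 7 [Common 1 8
     [Contains 58 [1, 2, 0, 5, 6, 8, 7, 3, 4], Neighbour 3 [Neighbour 5 [Contains 54 [3, 4, 0, 8,
     6, 7, 5, 1, 2], Contains 54 [1, 2, 0, 6, 5, 8, 7, 4, 3], Common 1 9 [Record 59 (Common 3 9
     [Common 2 9 [Contains 9 [0, 1, 2, 3, 4, 6, 5, 8, 7, 9]]])]], Contains 55 [0, 1, 2, 4, 3, 6,
     5, 8, 7], Contains 55 [0, 2, 1, 4, 3, 8, 7, 6, 5], Common 0 9 [Common 3 5 [Common 3 7
     [Contains 48 [4, 9, 5, 7, 0, 3, 2, 1], Contains 59 [2, 0, 1, 8, 7, 4, 3, 6, 5, 9]], Contains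
     59 [1, 0, 2, 5, 6, 3, 4, 7, 8, 9]]]]], Common 1 8 [Neighbour 3 [Record 60 (Common 3 5
     [Contains 56 [1, 2, 0, 6, 5, 7, 8, 4, 3], Common 3 7 [Contains 19 [0, 1, 2, 3, 4, 6, 5, 8,
     7]]]), Contains 56 [0, 1, 2, 4, 3, 6, 5, 8, 7], Contains 56 [0, 2, 1, 4, 3, 8, 7, 6, 5],
     Common 0 9 [Neighbour 5 [Contains 60 [1, 0, 2, 5, 6, 3, 4, 8, 7], Contains 56 [1, 2, 0, 6, 5,
     7, 8, 4, 3], Contains 47 [4, 5, 9, 7, 0, 1, 2, 3], Common 1 10 [Common 3 10 [Neighbour 9
     [Contains 47 [4, 7, 9, 5, 0, 2, 1, 3], Contains 47 [3, 8, 9, 6, 0, 2, 1, 4], Common 3 11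
     [Common 2 11 [Common 5 11 [Contains 7 [0, 1, 2, 3, 4, 6, 5, 8, 7, 9, 10, 11]]]]], Contains 47
     [6, 8, 10, 3, 1, 2, 0, 5]]]]]], Contains 58 [1, 2, 0, 6, 5, 8, 7, 4, 3]]])]), Contains 62 [0,
     1, 2, 4, 3, 6, 5, 7, 8]]]), Contains 63 [0, 1, 2, 4, 3, 5, 6, 7, 8]]]])]])]]),
     Record 77 (Neighbour 2 [Contains 53 [2, 3, 0, 1], Contains 53 [2, 4, 0, 1], Contains 53 [2,
     5, 0, 1], Neighbour 2 [Common 0 6 [Record 76 (Neighbour 5 [Contains 52 [5, 3, 0, 1, 6],
     Contains 52 [5, 4, 0, 1, 6], Neighbour 3 [Contains 53 [3, 4, 0, 1], Record 71 (Neighbour 3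
     [Record 68 (Neighbour 4 [Record 67 (Neighbour 4 [Contains 16 [0, 2, 3, 4, 5, 1, 6, 7], Common
     0 8 []]), Contains 67 [0, 1, 2, 3, 4, 5, 7, 6], Common 0 8 []]), Common 0 8 [Record 70
     (Neighbour 4 [Contains 68 [2, 5, 0, 1, 7, 6, 3, 4], Record 69 (Neighbour 6 [Contains 51 [6,
     7, 2, 5, 3, 4], Contains 64 [3, 6, 8, 0, 1, 2, 5], Common 2 9 [Common 3 9 [Neighbour 8
     [Common 3 10 []]]]]), Common 0 9 []])]]), Contains 71 [0, 1, 2, 3, 4, 5, 7, 6], Common 0 8
     [Neighbour 3 [Common 0 9 [Contains 23 [6, 7, 2, 5, 0, 1, 3, 4, 8, 9]]]]], Common 0 7 [Record
     75 (Common 0 8 [Neighbour 6 [Record 72 (Neighbour 3 [Contains 69 [0, 1, 2, 4, 5, 3, 7, 6, 8],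
     Contains 69 [0, 1, 3, 2, 4, 5, 6, 8, 7], Common 0 9 []]), Contains 65 [2, 6, 7, 0, 1],
     Contains 65 [5, 6, 8, 0, 1], Record 73 (Neighbour 3 [Contains 72 [0, 1, 2, 3, 5, 4, 7, 6, 8],
     Contains 72 [0, 1, 4, 3, 2, 5, 8, 7, 6], Common 0 9 [], Common 0 10 []])], Record 74
     (Neighbour 3 [Contains 51 [3, 4, 0, 1, 8, 7], Contains 70 [0, 1, 3, 2, 4, 5, 6, 8, 7],
     Contains 72 [0, 1, 2, 4, 5, 3, 7, 6, 8], Common 0 9 [Neighbour 6 [Contains 65 [2, 6, 7, 0,
     1], Contains 65 [5, 6, 8, 0, 1], Common 3 6 [], Common 2 10 [Common 4 10 [Common 3 10
     [Neighbour 6 [Common 2 11 [Common 4 11 [Common 3 11 [Contains 22 [2, 0, 1, 6, 7, 5, 4, 3, 11,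
     10, 8, 9]]]]]]]]]]])]), Contains 75 [0, 1, 2, 4, 3, 5, 6, 7, 8]]]), Contains 76 [0, 1, 2, 3,
     5, 4, 6, 7], Contains 76 [0, 1, 2, 4, 5, 3, 6, 7]]]]),
     Record 94 (Neighbour 0 [Contains 36 [0, 1, 2, 3, 4], Record 93 (Neighbour 1 [Contains 77 [0,
     1, 2, 3, 4, 5], Neighbour 2 [Contains 53 [2, 3, 0, 1], Contains 53 [2, 4, 0, 1], Contains 65
     [0, 2, 5, 3, 4], Contains 65 [1, 2, 6, 3, 4], Neighbour 2 [Common 2 5 [Record 92 (Common 2 6
     [Record 90 (Neighbour 5 [Contains 65 [0, 3, 5, 2, 4], Contains 65 [0, 4, 5, 2, 3], Contains
     66 [5, 8, 6], Neighbour 5 [Record 85 (Common 0 9 [Record 84 (Common 1 9 [Record 83 (Neighbour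
     6 [Contains 64 [1, 6, 3, 2, 4, 8, 9], Contains 51 [4, 6, 1, 9, 0, 8], Record 81 (Neighbour 9
     [Record 79 (Neighbour 3 [Contains 34 [3, 4, 0, 1, 9, 5, 2, 6, 8, 7], Record 78 (Neighbour 4
     [Contains 11 [0, 2, 3, 4, 5, 1, 7, 8, 9, 6], Common 0 10 []]), Contains 78 [0, 1, 2, 3, 4, 5,
     6, 8, 7, 9], Common 0 10 [Contains 73 [3, 4, 0, 10, 1, 9, 5, 2, 6, 8]]]), Contains 51 [7, 9,
     5, 6, 2, 4], Contains 51 [8, 9, 5, 6, 2, 4], Record 80 (Neighbour 4 [Contains 52 [4, 3, 0, 1,
     9], Common 4 10 [], Common 4 10 [], Contains 64 [4, 9, 10, 0, 1, 5, 6], Common 0 11 [Common 5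
     3 [Common 7 11 [], Common 8 11 []]]])]), Record 82 (Neighbour 9 [Contains 80 [2, 5, 0, 7, 8,
     1, 9, 4, 3, 6, 10], Contains 64 [5, 9, 7, 0, 8, 4, 6], Contains 51 [8, 9, 5, 6, 2, 4],
     Contains 64 [6, 9, 10, 8, 1, 4, 5], Neighbour 10 [Common 0 10 [Common 1 7 [Common 4 11
     [Common 3 11 [Common 2 11 [Contains 12 [0, 2, 3, 5, 4, 7, 1, 8, 10, 9, 11, 6]]]]]], Common 0
     10 [], Common 1 10 [], Contains 64 [6, 8, 10, 1, 9, 2, 5], Common 1 10 [], Common 1 10
     []]])]), Common 5 6 [Contains 81 [2, 5, 0, 7, 8, 1, 9, 4, 3, 6], Neighbour 6 [Contains 58 [1,
     6, 3, 4, 2, 8, 7, 0, 9], Contains 58 [1, 6, 4, 3, 2, 8, 7, 0, 9], Contains 79 [0, 1, 2, 3, 4,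
     5, 6, 7, 8, 9], Common 6 3 [Common 0 10 [Contains 74 [3, 4, 0, 10, 9, 1, 2, 5, 6]], Contains
     82 [0, 1, 3, 4, 2, 5, 6, 9, 7, 8, 10], Contains 82 [0, 1, 3, 4, 2, 5, 6, 9, 8, 7, 10]]]]]),
     Contains 84 [0, 1, 2, 4, 3, 5, 6, 7, 8, 9]])], Neighbour 5 [Record 89 (Common 0 7 [Record 88
     (Common 0 9 [Record 87 (Common 0 10 [Common 1 10 [Record 86 (Common 1 9 [Neighbour 3
     [Neighbour 7 [Contains 57 [2, 7, 8, 1, 0, 4, 3, 5, 6], Contains 57 [4, 7, 9, 1, 0, 3, 2, 5,
     6], Contains 57 [3, 7, 10, 1, 0, 4, 2, 5, 6], Common 2 11 [Common 3 11 [Common 4 11 [Contains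
     8 [0, 2, 3, 4, 5, 1, 7, 8, 10, 9, 6, 11]]]]], Contains 80 [5, 6, 8, 10, 9, 0, 1, 3, 2, 4, 7],
     Contains 80 [5, 6, 9, 10, 8, 0, 1, 4, 3, 2, 7], Common 0 11 []], Contains 83 [0, 1, 3, 4, 2,
     5, 6, 9, 10, 8]])]]), Common 0 10 [Contains 87 [0, 1, 2, 3, 4, 5, 6, 7, 8, 10, 9], Contains
     85 [3, 5, 0, 10, 9, 1, 8, 4, 2, 6]]]), Contains 88 [0, 1, 2, 4, 3, 5, 6, 7, 8, 9, 10]])]]),
     Neighbour 5 [Contains 65 [0, 3, 5, 2, 4], Contains 65 [0, 4, 5, 2, 3], Common 1 5 [],
     Contains 90 [0, 1, 2, 3, 4, 5, 6, 8, 7], Neighbour 5 [Common 0 7 [Record 91 (Common 5 4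
     [Contains 90 [2, 4, 0, 1, 7, 8, 10, 3, 5], Contains 90 [2, 4, 0, 1, 7, 8, 9, 3, 5], Contains
     74 [2, 4, 0, 7, 8, 1, 3, 5, 6]]), Contains 91 [0, 1, 2, 4, 3, 5, 6, 7, 8, 9, 10]]]]]),
     Contains 92 [0, 1, 2, 3, 4, 5, 6, 8, 7]]]]])]),
     Record 99 (Neighbour 0 [Neighbour 0 [Neighbour 0 [Neighbour 0 [Neighbour 1 [Contains 65 [0,
     1, 2, 3, 4], Contains 65 [0, 1, 3, 2, 4], Contains 65 [0, 1, 4, 2, 3], Neighbour 1 [Neighbour
     1 [Common 0 5 [Record 98 (Neighbour 4 [Contains 65 [0, 2, 4, 1, 3], Contains 65 [0, 3, 4, 1,
     2], Contains 93 [1, 4, 0, 5, 6, 7], Contains 93 [1, 4, 0, 5, 7, 6], Neighbour 4 [Neighbour 5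
     [Contains 93 [0, 5, 1, 2, 4, 3], Contains 93 [0, 5, 1, 3, 4, 2], Contains 65 [1, 5, 6, 0, 7],
     Contains 65 [1, 5, 7, 0, 6], Contains 65 [4, 8, 5, 0, 9], Contains 65 [4, 5, 9, 0, 8],
     Neighbour 5 [Common 0 6 [Record 97 (Common 0 7 [Contains 93 [1, 3, 0, 6, 7, 5], Common 0 8
     [Record 96 (Common 0 9 [Contains 89 [4, 3, 0, 8, 9, 5, 6, 2, 1, 11, 10], Neighbour 2
     [Contains 61 [0, 2, 3, 1, 4, 9, 7, 8, 6], Contains 88 [1, 2, 0, 7, 6, 5, 9, 3, 4, 11, 10],
     Contains 88 [4, 2, 0, 9, 8, 5, 7, 3, 1, 11, 10], Common 2 5 [], Common 2 5 [], Common 0 12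
     [Common 1 10 [Record 95 (Common 1 11 [Contains 89 [5, 7, 1, 10, 11, 4, 2, 6, 0, 9, 8],
     Neighbour 6 [Contains 61 [1, 6, 7, 0, 5, 11, 3, 10, 2], Contains 64 [3, 6, 8, 0, 12, 11, 1],
     Common 2 6 [], Contains 88 [5, 6, 1, 11, 10, 4, 3, 7, 0, 9, 8], Contains 64 [3, 6, 12, 0, 8,
     11, 1], Common 1 13 [Common 2 10 [Common 3 10 [Common 5 9 [Common 2 11 [Common 2 13 [Common 3
     13 [Contains 13 [0, 1, 2, 3, 4, 7, 6, 5, 12, 9, 8, 13, 10, 11]]]]]], Common 2 13 [Common 3 11
     [Contains 89 [6, 12, 3, 11, 13, 1, 2, 8, 0, 7, 5], Neighbour 8 [Contains 61 [4, 8, 9, 0, 5,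
     11, 3, 10, 2], Contains 86 [4, 10, 5, 9, 8, 0, 7, 11, 1, 3, 2], Contains 61 [3, 8, 12, 0, 6,
     11, 4, 13, 2], Contains 86 [3, 13, 6, 12, 8, 0, 7, 11, 1, 4, 2], Common 3 14 [Common 2 14
     [Neighbour 10 [Contains 61 [5, 10, 11, 1, 4, 9, 7, 8, 6], Contains 61 [7, 10, 13, 1, 2, 9, 5,
     12, 6], Contains 61 [9, 10, 14, 2, 4, 5, 7, 8, 12], Common 5 15 [Common 6 15 [Common 8 15
     [Contains 14 [0, 1, 2, 3, 4, 7, 6, 5, 12, 9, 8, 13, 10, 11, 14, 15]]]]]]]]], Contains 89 [7,
     9, 2, 10, 13, 1, 4, 12, 0, 6, 5]]]]]]), Contains 95 [0, 1, 3, 2, 4, 5, 7, 6, 9, 8, 10, 11,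
     12]]]]]), Contains 96 [0, 1, 3, 2, 4, 5, 7, 6, 8, 9, 10, 11]]]), Contains 97 [0, 1, 3, 2, 4,
     5, 6, 7, 8, 9, 10, 11]]]]]]), Contains 98 [0, 1, 2, 4, 3, 5, 6, 7], Contains 98 [0, 1, 3, 4,
     2, 5, 6, 7]]]]]]]]])]"

lemma refutes_all_seeds: "refutes_all 4 outcomes (map edges_only seeds) refutations \<noteq> None"
  by code_simp

lemma wf_partial_graph_edges_only:
  "wf_partial_graph (edges_only A) \<longleftrightarrow> (\<forall>ns \<in> set A. distinct ns \<and> (\<forall>j \<in> set ns. j < length A))"
  by (auto simp: edges_only_def all_set_conv_all_nth[of A])

lemma wf_partial_graph_search:
  "list_all wf_partial_graph (map edges_only (seeds @ catalogue @ spurious @ [twin_chain_5_adj]))"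
  unfolding list.pred_map comp_def wf_partial_graph_edges_only by code_simp

lemma quartic_catalogue_spurious:
  "\<forall>A \<in> set (catalogue @ spurious). A \<noteq> [] \<and> (\<forall>ns \<in> set A. length ns = 4)"
  by code_simp

lemma (in quadrangular_graph) adjacency_labelling_if_realizes:
  assumes conn: "Digraph_Component.connected (with_proj G)"
    and f: "realizes f (A, Q)" and wf: "wf_partial_graph (A, Q)"
    and A: "A \<noteq> []" "\<forall>ns \<in> set A. length ns = r"
  shows "adjacency_labelling A f G"
proof -
  have len: "length (A ! i) = r" if "i < length A" for i using A(2) that by simp
  have "f ` {..<length A} = pverts G"
  proof (rule connected_closed_under_adj[OF conn])
    show "f ` {..<length A} \<subseteq> pverts G" using f by simp
    show "f ` {..<length A} \<noteq> {}" using A(1) by auto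
    fix u v assume "u \<in> f ` {..<length A}" "adj u v"
    then obtain i where "i < length A" "v \<in> f ` set (A ! i)"
      using neighbours_eq_if_all_known[OF f wf _ len] by blast
    then show "v \<in> f ` {..<length A}" using wf by auto
  qed
  then show ?thesis
    using f adj_iff_if_all_known[OF f wf _ len]
    unfolding adjacency_labelling_def bij_betw_def by simp
qed

context quartic_quadrangular_graph
begin

lemma occurs_outcome: "\<exists>A \<in> set (catalogue @ spurious @ [twin_chain_5_adj]). occurs (edges_only A)"
proof (rule ccontr)
  assume no: "\<not> ?thesis"
  then have "list_all refuted (map snd outcomes)"
    using wf_partial_graph_search unfolding outcomes_def list_all_iff refuted_def by auto
  moreover have "list_all wf_partial_graph (map edges_only seeds)"
    using wf_partial_graph_search by simp
  ultimately have "list_all refuted (map edges_only seeds)"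
    using refutes_all_seeds refutes_sound(2) by blast
  then have "\<not> occurs (edges_only [[]])" by (simp add: seeds_def refuted_def)
  moreover obtain v where "v \<in> pverts G"
    using connected unfolding Digraph_Component.connected_def strongly_connected_def by auto
  then have "realizes (\<lambda>_. v) (edges_only [[]])" by (auto simp: edges_only_def inj_on_def)
  ultimately show False unfolding occurs_def by blast
qed

lemma twin_chain_if_realizes:
  assumes f: "realizes f (edges_only twin_chain_5_adj)"
  shows "twin_chain (\<lambda>p. {f (2 * p), f (2 * p + 1)}) 5"
proof -
  have "length twin_chain_5_adj = 10" by (simp add: twin_chain_5_adj_def)
  then have inj: "inj_on f {..<10}" and verts: "f ` {..<10} \<subseteq> pverts G"
    and adj: "\<And>i j. i < 10 \<Longrightarrow> j \<in> set (twin_chain_5_adj ! i) \<Longrightarrow> adj (f i) (f j)"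
    using f by (auto simp: edges_only_def)
  have f_eq: "f i = f j \<longleftrightarrow> i = j" if "i < 10" "j < 10" for i j
    using inj_on_eq_iff[OF inj] that by auto
  have "adj x y" if p: "Suc p < 5" and "x \<in> {f (2 * p), f (2 * p + 1)}"
    "y \<in> {f (2 * Suc p), f (2 * Suc p + 1)}" for p x y
  proof -
    have "p \<in> {0, 1, 2, 3}" using p by auto
    then have "\<forall>i \<in> {2 * p, 2 * p + 1}. {2 * Suc p, 2 * Suc p + 1} \<subseteq> set (twin_chain_5_adj ! i)"
      by (elim insertE) (simp_all add: twin_chain_5_adj_def)
    then show ?thesis using that adj[of "2 * p"] adj[of "2 * p + 1"] by auto
  qed
  moreover have "card {f (2 * p), f (2 * p + 1)} = 2 \<and> {f (2 * p), f (2 * p + 1)} \<subseteq> pverts G"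
    if "p < 5" for p
    using that f_eq[of "2 * p" "2 * p + 1"] verts by auto
  moreover have "{f (2 * p), f (2 * p + 1)} \<inter> {f (2 * q), f (2 * q + 1)} = {}"
    if "p < 5" "q < 5" "p \<noteq> q" for p q
    using that f_eq[of "2 * p" "2 * q"] f_eq[of "2 * p" "2 * q + 1"] f_eq[of "2 * p + 1" "2 * q"]
      f_eq[of "2 * p + 1" "2 * q + 1"] by simp
  ultimately show ?thesis unfolding twin_chain_def disjoint_family_on_def by simp
qed

theorem closed_candle_or_adjacency_labelling:
  obtains (candle) k where "3 \<le> k" "graph_iso G (closed_candle k)"
  | (labelled) A c where "A \<in> set (catalogue @ spurious)" "adjacency_labelling A c G"
proof -
  obtain A f where A: "A \<in> set (catalogue @ spurious @ [twin_chain_5_adj])"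
    and f: "realizes f (edges_only A)"
    using occurs_outcome unfolding occurs_def by blast
  then consider (chain) "A = twin_chain_5_adj" | (graph) "A \<in> set (catalogue @ spurious)" by auto
  then show thesis
  proof cases
    case chain
    then have "twin_chain (\<lambda>p. {f (2 * p), f (2 * p + 1)}) (0 + 5)"
      using twin_chain_if_realizes f by simp
    then obtain P n where "closed_twin_chain P (n + 5)" by (rule twin_chain_closes)
    then show thesis using candle[of "n + 5"] graph_iso_closed_candle_if_closed_twin_chain by simp
  next
    case graph
    have "wf_partial_graph (edges_only A)"
      using wf_partial_graph_search A by (auto simp: list_all_iff)
    then show thesis
      using labelled[OF graph] adjacency_labelling_if_realizes[OF connected] f graph
        quartic_catalogue_spurious unfolding edges_only_def by blast
  qed
qed

end

section \<open>Graphs excluded by signs and diagonal entries\<close>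

definition common_neighbours :: "nat list list \<Rightarrow> nat \<Rightarrow> nat \<Rightarrow> nat list" where
  "common_neighbours A i j = filter (\<lambda>k. k \<in> set (A ! i) \<and> k \<in> set (A ! j)) [0..<length A]"

locale labelled_two_eigenvalue_weighting = two_eigenvalue_weighting G w d
  for G :: "'a pair_pre_digraph" and w d +
  fixes A :: "nat list list" and c :: "nat \<Rightarrow> 'a"
  assumes labelling: "adjacency_labelling A c G"
begin

abbreviation W :: "nat \<Rightarrow> nat \<Rightarrow> real" where "W i j \<equiv> w (c i) (c j)"

abbreviation D :: "nat \<Rightarrow> real" where "D i \<equiv> d (c i)"

lemma label_in_verts: "i < length A \<Longrightarrow> c i \<in> pverts G"
  using labelling bij_betwE unfolding adjacency_labelling_def by blast

lemma label_eq_iff: "i < length A \<Longrightarrow> j < length A \<Longrightarrow> c i = c j \<longleftrightarrow> i = j"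
  using labelling unfolding adjacency_labelling_def bij_betw_def inj_on_def by blast

lemma adj_label_iff: "i < length A \<Longrightarrow> j < length A \<Longrightarrow> adj (c i) (c j) \<longleftrightarrow> j \<in> set (A ! i)"
  using labelling unfolding adjacency_labelling_def by blast

lemma W_nonzero_iff: "i < length A \<Longrightarrow> j < length A \<Longrightarrow> W i j \<noteq> 0 \<longleftrightarrow> j \<in> set (A ! i)"
  using weight_nonzero_iff adj_label_iff by blast

lemma common_neighbours_image:
  assumes "i < length A" "j < length A"
  shows "{x. adj (c i) x \<and> adj (c j) x} = c ` set (common_neighbours A i j)"
proof -
  have "c ` {..<length A} = pverts G"
    using labelling unfolding adjacency_labelling_def bij_betw_def by blast
  then have "x \<in> c ` {..<length A}" if "adj (c i) x" for x using that in_arcsD2 by blast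
  then have "{x. adj (c i) x \<and> adj (c j) x} =
      c ` {k. k < length A \<and> adj (c i) (c k) \<and> adj (c j) (c k)}"
    by blast
  also have "{k. k < length A \<and> adj (c i) (c k) \<and> adj (c j) (c k)} = set (common_neighbours A i j)"
    using assms adj_label_iff by (auto simp: common_neighbours_def)
  finally show ?thesis .
qed

lemma W_orthogonal:
  assumes ij: "i < length A" "j < length A" "i \<noteq> j"
  shows "(D i + D j) * W i j + (\<Sum>k\<leftarrow>common_neighbours A i j. W i k * W j k) = 0"
proof -
  have "inj_on c (set (common_neighbours A i j))"
    using label_eq_iff by (auto simp: common_neighbours_def inj_on_def)
  moreover have "distinct (common_neighbours A i j)" by (simp add: common_neighbours_def)
  ultimately show ?thesis
    using weight_orthogonal_common_neighbours[of "c i" "c j"] ij label_in_verts label_eq_iff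
    by (simp add: common_neighbours_image sum.reindex sum_list_distinct_conv_sum_set)
qed

lemma W_quadrangle_negative:
  assumes ij: "i < length A" "j < length A" "i \<noteq> j" "j \<notin> set (A ! i)"
    and kl: "common_neighbours A i j = [k, l]"
  shows "(W i k * W j k) * (W i l * W j l) < 0"
proof (rule common_neighbour_pair_product_negative)
  have "distinct (common_neighbours A i j)" "set (common_neighbours A i j) \<subseteq> {..<length A}"
    by (auto simp: common_neighbours_def)
  then show "c k \<noteq> c l" using label_eq_iff unfolding kl by auto
  show "{x. adj (c i) x \<and> adj (c j) x} = {c k, c l}"
    using common_neighbours_image[OF ij(1,2)] kl by simp
qed (use ij label_in_verts label_eq_iff adj_label_iff in auto)

lemma D_opposite:
  assumes "i < length A" "j < length A" "j \<in> set (A ! i)" "common_neighbours A i j = []"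
  shows "D i + D j = 0"
  using diagonal_opposite_if_no_common_neighbour[of "c i" "c j"] adj_label_iff
    common_neighbours_image assms by simp

end

text \<open>
  The weights around a quadrangle \<open>(i, j, k, l)\<close> with diagonals \<open>i j\<close> and \<open>k l\<close> have negative
  product. If an odd number of quadrangles covers every edge an even number of times, then the
  product over all of them is negative and at the same time a square.
\<close>

fun quadrangle_edges :: "nat \<times> nat \<times> nat \<times> nat \<Rightarrow> (nat \<times> nat) list" where
  "quadrangle_edges (i, j, k, l) =
     map (\<lambda>(u, v). (min u v, max u v)) [(i, k), (j, k), (i, l), (j, l)]"

definition odd_quadrangle_cover :: "nat list list \<Rightarrow> (nat \<times> nat \<times> nat \<times> nat) list \<Rightarrow> bool" where
  "odd_quadrangle_cover A qs \<longleftrightarrow> odd (length qs) \<and>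
     (\<forall>(i, j, k, l) \<in> set qs. i < length A \<and> j < length A \<and> i \<noteq> j \<and> j \<notin> set (A ! i) \<and>
        common_neighbours A i j = [k, l]) \<and>
     (let es = concat (map quadrangle_edges qs) in \<forall>e \<in> set es. even (count_list es e))"

lemma prod_list_sign_if_all_neg:
  fixes xs :: "'a :: linordered_idom list"
  assumes "\<forall>x \<in> set xs. x < 0"
  shows "odd (length xs) \<Longrightarrow> prod_list xs < 0" "even (length xs) \<Longrightarrow> 0 < prod_list xs"
  using assms by (induction xs) (auto simp: mult_neg_pos mult_neg_neg)

lemma prod_list_nonneg_if_even_count:
  fixes f :: "'a \<Rightarrow> 'b :: linordered_idom"
  assumes "\<forall>x \<in> set xs. even (count_list xs x)"
  shows "0 \<le> prod_list (map f xs)"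
proof -
  have "prod_list (map f xs) = (\<Prod>x\<in>set xs. f x ^ count_list xs x)"
    using image_prod_mset_multiplicity[of f "mset xs"]
    by (simp add: prod_mset_prod_list count_mset flip: mset_map)
  then show ?thesis using assms by (simp add: prod_nonneg zero_le_even_power)
qed

lemma (in labelled_two_eigenvalue_weighting) no_odd_quadrangle_cover: "\<not> odd_quadrangle_cover A qs"
proof
  assume qs: "odd_quadrangle_cover A qs"
  let ?f = "\<lambda>(u, v). W u v" and ?g = "\<lambda>(i, j, k, l). (W i k * W j k) * (W i l * W j l)"
  let ?es = "concat (map quadrangle_edges qs)"
  have "prod_list (map ?f (quadrangle_edges q)) = ?g q" for q
    using weight_commute by (cases q) (simp add: min_def max_def)
  then have "prod_list (map ?f ?es) = prod_list (map ?g qs)" by (induction qs) simp_all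
  also have "\<dots> < 0"
  proof (rule prod_list_sign_if_all_neg(1))
    show "\<forall>x \<in> set (map ?g qs). x < 0"
      using qs W_quadrangle_negative unfolding odd_quadrangle_cover_def by fastforce
  qed (use qs in \<open>simp add: odd_quadrangle_cover_def\<close>)
  finally show False
    using qs prod_list_nonneg_if_even_count[of ?es ?f]
    unfolding odd_quadrangle_cover_def Let_def by simp
qed

lemma odd_quadrangle_cover_K3_K3:
  "odd_quadrangle_cover K3_K3_adj
     [(0, 5, 1, 3), (0, 6, 1, 4), (0, 7, 2, 3), (0, 8, 2, 4), (1, 7, 2, 5), (1, 8, 2, 6),
      (3, 6, 4, 5), (3, 8, 4, 7), (5, 8, 6, 7)]"
  by code_simp

lemma odd_quadrangle_cover_S_9_3:
  "odd_quadrangle_cover S_9_3_adj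
     [(0, 6, 1, 3), (0, 8, 2, 4), (1, 4, 0, 5), (1, 7, 2, 6), (2, 3, 0, 7), (2, 5, 1, 8),
      (3, 8, 5, 6), (4, 6, 7, 8), (5, 7, 3, 4)]"
  by code_simp

lemma odd_quadrangle_cover_S_12:
  "odd_quadrangle_cover S_12_adj
     [(0, 7, 1, 2), (1, 3, 0, 5), (1, 10, 5, 7), (2, 3, 0, 5), (2, 10, 5, 7)]"
  by code_simp

lemma nodes_eq_if_three_moments_eq_0:
  fixes x y z a b c :: "'a :: idom"
  assumes "x + y + z = 0" "a * x + b * y + c * z = 0" "a\<^sup>2 * x + b\<^sup>2 * y + c\<^sup>2 * z = 0"
    and "x \<noteq> 0" "y \<noteq> 0" "z \<noteq> 0"
  shows "a = b" "a = c"
proof -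
  have "(a - b) * (a - c) * x = a\<^sup>2 * x + b\<^sup>2 * y + c\<^sup>2 * z - (b + c) * (a * x + b * y + c * z)
      + b * c * (x + y + z)"
    "(b - a) * (b - c) * y = a\<^sup>2 * x + b\<^sup>2 * y + c\<^sup>2 * z - (a + c) * (a * x + b * y + c * z)
      + a * c * (x + y + z)"
    "(c - a) * (c - b) * z = a\<^sup>2 * x + b\<^sup>2 * y + c\<^sup>2 * z - (a + b) * (a * x + b * y + c * z)
      + a * b * (x + y + z)"
    by (simp_all add: algebra_simps power2_eq_square)
  then have "a = b \<or> a = c" "b = a \<or> b = c" "c = a \<or> c = b" using assms by simp_all
  then show "a = b" "a = c" by auto
qed

lemma no_three_opposite_products:
  fixes p q x y z x' y' z' :: real
  assumes "0 < p" "0 < q" "x \<noteq> 0" "y \<noteq> 0" "z \<noteq> 0"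
    and opp: "p * (x * y) = - (q * (x' * y'))" "p * (x * z) = - (q * (x' * z'))"
      "p * (y * z) = - (q * (y' * z'))"
  shows False
proof -
  have "0 < p ^ 3 * (x * y * z)\<^sup>2" using assms by simp
  also have "\<dots> = (p * (x * y)) * (p * (x * z)) * (p * (y * z))"
    by (simp add: power2_eq_square power3_eq_cube)
  also have "\<dots> = - (q ^ 3 * (x' * y' * z')\<^sup>2)"
    unfolding opp by (simp add: power2_eq_square power3_eq_cube)
  also have "\<dots> \<le> 0" using \<open>0 < q\<close> by simp
  finally show False by simp
qed

context labelled_two_eigenvalue_weighting
begin

lemma not_S_9_2: "A \<noteq> S_9_2_adj"
proof
  assume A: "A = S_9_2_adj"
  note eval = A common_neighbours_def S_9_2_adj_def upt_rec
  have "D 3 + D 5 = 0" "D 5 + D 8 = 0" "D 8 + D 4 = 0" by (rule D_opposite; simp add: eval)+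
  then have "D 3 + D 4 = 0" by simp
  moreover have "(D 3 + D 4) * W 3 4 + W 3 0 * W 4 0 = 0"
    using W_orthogonal[of 3 4] by (simp add: eval)
  moreover have "W 3 0 \<noteq> 0" "W 4 0 \<noteq> 0" by (subst W_nonzero_iff; simp add: eval)+
  ultimately show False by simp
qed

end

lemma common_neighbours_S_7_adj:
  "\<forall>t \<in> {2, 3, 4}. common_neighbours S_7_adj 0 t = [1] \<and> common_neighbours S_7_adj 5 t = [6]"
  "\<forall>i \<in> {0, 1}. \<forall>j \<in> {5, 6}. common_neighbours S_7_adj i j = [2, 3, 4]"
  "\<forall>s \<in> {2, 3, 4}. \<forall>t \<in> {2, 3, 4}. s \<noteq> t \<longrightarrow> common_neighbours S_7_adj s t = [0, 1, 5, 6]"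
  by code_simp+

context labelled_two_eigenvalue_weighting
begin

text \<open>
  In \<open>S_7_adj\<close>, the vertices 2, 3, 4 are joined to the ends of the edges 01 and 56. The triangles
  through these edges express the weights at 1 and 6 by those at 0 and 5, and orthogonality of 0, 1
  to 5, 6 turns into three Vandermonde equations for the diagonal entries at 2, 3, 4.
\<close>

lemma S_7_triangles:
  assumes A: "A = S_7_adj" and t: "t \<in> {2, 3, 4}"
  shows "W 0 1 * W 1 t = - (D 0 + D t) * W 0 t" "W 5 6 * W 6 t = - (D 5 + D t) * W 5 t"
  using W_orthogonal[of 0 t] W_orthogonal[of 5 t] common_neighbours_S_7_adj(1) t
  by (auto simp: A S_7_adj_def weight_commute algebra_simps add_eq_0_iff)

lemma S_7_diagonal_eq:
  assumes A: "A = S_7_adj"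
  shows "D 2 = D 3" "D 2 = D 4"
proof -
  let ?T = "{2, 3, 4 :: nat}"
  note triangles = S_7_triangles[OF A]
  have orth: "(\<Sum>t\<in>?T. W i t * W j t) = 0" if "i \<in> {0, 1}" "j \<in> {5, 6}" for i j
    using W_orthogonal[of i j] W_nonzero_iff[of i j] common_neighbours_S_7_adj(2) that
    by (auto simp: A S_7_adj_def)
  define x where "x t = W 0 t * W 5 t" for t
  have moment0: "(\<Sum>t\<in>?T. x t) = 0" using orth[of 0 5] by (simp add: x_def)
  have "W 0 1 * (\<Sum>t\<in>?T. W 1 t * W 5 t) = (\<Sum>t\<in>?T. (W 0 1 * W 1 t) * W 5 t)"
    by (simp only: sum_distrib_left mult.assoc)
  also have "\<dots> = (\<Sum>t\<in>?T. - (D 0 * x t + D t * x t))"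
    by (rule sum.cong[OF refl], subst triangles(1)) (simp_all add: x_def algebra_simps)
  also have "\<dots> = - (D 0 * (\<Sum>t\<in>?T. x t) + (\<Sum>t\<in>?T. D t * x t))"
    by (simp only: sum_negf sum.distrib sum_distrib_left)
  finally have moment1: "(\<Sum>t\<in>?T. D t * x t) = 0" using orth[of 1 5] moment0 by simp
  have "W 0 1 * W 5 6 * (\<Sum>t\<in>?T. W 1 t * W 6 t) = (\<Sum>t\<in>?T. (W 0 1 * W 1 t) * (W 5 6 * W 6 t))"
    by (simp only: sum_distrib_left mult_ac)
  also have "\<dots> = (\<Sum>t\<in>?T. D 0 * D 5 * x t + (D 0 + D 5) * (D t * x t) + (D t)\<^sup>2 * x t)"
    by (rule sum.cong[OF refl], subst triangles(1), assumption, subst triangles(2))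
      (simp_all add: x_def algebra_simps power2_eq_square)
  also have "\<dots> = D 0 * D 5 * (\<Sum>t\<in>?T. x t) + (D 0 + D 5) * (\<Sum>t\<in>?T. D t * x t) +
      (\<Sum>t\<in>?T. (D t)\<^sup>2 * x t)"
    by (simp only: sum.distrib sum_distrib_left)
  finally have moment2: "(\<Sum>t\<in>?T. (D t)\<^sup>2 * x t) = 0" using orth[of 1 6] moment0 moment1 by simp
  have "W u t \<noteq> 0" if "u \<in> {0, 5}" "t \<in> ?T" for u t
    using that by (subst W_nonzero_iff) (auto simp: A S_7_adj_def)
  then have "x 2 \<noteq> 0" "x 3 \<noteq> 0" "x 4 \<noteq> 0" by (simp_all add: x_def)
  then show "D 2 = D 3" "D 2 = D 4"
    using nodes_eq_if_three_moments_eq_0[of "x 2" "x 3" "x 4" "D 2" "D 3" "D 4"] moment0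
      moment1 moment2 by (simp_all add: add.assoc)
qed

text \<open>
  With equal diagonal entries, the weights at 1 and 6 are multiples of those at 0 and 5, so that
  \<open>W 0 s * W 0 t\<close> and \<open>W 5 s * W 5 t\<close> have opposite signs for all distinct \<open>s\<close> and \<open>t\<close> among
  2, 3, 4.
\<close>

lemma not_S_7: "A \<noteq> S_7_adj"
proof
  assume A: "A = S_7_adj"
  have nonzero: "W 0 1 \<noteq> 0" "W 5 6 \<noteq> 0" by (subst W_nonzero_iff; simp add: A S_7_adj_def)+
  define \<beta> \<gamma> where "\<beta> = - (D 0 + D 2) / W 0 1" and "\<gamma> = - (D 5 + D 2) / W 5 6"
  have \<beta>: "W 1 t = \<beta> * W 0 t" and \<gamma>: "W 6 t = \<gamma> * W 5 t" if "t \<in> {2, 3, 4}" for t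
    using that S_7_triangles[OF A that] S_7_diagonal_eq[OF A] nonzero
    by (auto simp: \<beta>_def \<gamma>_def field_simps)
  have opposite: "(1 + \<beta>\<^sup>2) * (W 0 s * W 0 t) = - ((1 + \<gamma>\<^sup>2) * (W 5 s * W 5 t))"
    if "s \<in> {2, 3, 4}" "t \<in> {2, 3, 4}" "s \<noteq> t" for s t
  proof -
    have "W 0 s * W 0 t + W 1 s * W 1 t + W 5 s * W 5 t + W 6 s * W 6 t = 0"
      using W_orthogonal[of s t] W_nonzero_iff[of s t] common_neighbours_S_7_adj(3) that
      by (auto simp: A S_7_adj_def weight_commute)
    then show ?thesis unfolding \<beta>[OF that(1)] \<beta>[OF that(2)] \<gamma>[OF that(1)] \<gamma>[OF that(2)]
      by (simp add: algebra_simps power2_eq_square)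
  qed
  have "0 < 1 + \<beta>\<^sup>2" "0 < 1 + \<gamma>\<^sup>2" by (simp_all add: add_pos_nonneg)
  moreover have "W 0 2 \<noteq> 0" "W 0 3 \<noteq> 0" "W 0 4 \<noteq> 0"
    by (subst W_nonzero_iff; simp add: A S_7_adj_def)+
  ultimately show False by (rule no_three_opposite_products) (rule opposite; simp)+
qed

theorem not_spurious: "A \<notin> set spurious"
  using not_S_7 not_S_9_2 no_odd_quadrangle_cover odd_quadrangle_cover_K3_K3
    odd_quadrangle_cover_S_9_3 odd_quadrangle_cover_S_12 unfolding spurious_def by auto

end

section \<open>The graphs of the catalogue\<close>

lemmas catalogue_simps =
  R_7_1_def R_8_2_def R_8_3_def R_8_4_def R_8_5_def R_8_6_def R_10_2_def R_10_3_def R_10_4_def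
  R_12_3_def R_14_1_def hypercube4_def cycle_graph_def
  pair_wf_digraph_undirected pair_wf_digraph_complete_graph pair_wf_digraph_circulant
  pair_wf_digraph_complete_bipartite_graph pair_wf_digraph_cartesian_product
  pair_wf_digraph_closed_candle
  pverts_simps parcs_simps parcs_closed_candle_iff candle_edge_def
  adjacency_lists_def numeral_2_eq_2[symmetric] card_Plus InlI InrI

lemma graph_iso_complete_5:
  assumes "pair_wf_digraph G" "adjacency_labelling K5_adj c G"
  shows "graph_iso G (complete_graph 5)"
  by (rule graph_iso_adjacency_lists[OF assms, where vs = "[0, 1, 2, 3, 4]"])
    (simp_all add: K5_adj_def catalogue_simps)

lemma graph_iso_R_7_1:
  assumes "pair_wf_digraph G" "adjacency_labelling R_7_1_adj c G"
  shows "graph_iso G R_7_1"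
  by (rule graph_iso_adjacency_lists[OF assms, where vs = "[0, 1, 6, 2, 5, 3, 4]"])
    (simp_all add: R_7_1_adj_def catalogue_simps)

lemma graph_iso_R_8_2:
  assumes "pair_wf_digraph G" "adjacency_labelling R_8_2_adj c G"
  shows "graph_iso G R_8_2"
  by (rule graph_iso_adjacency_lists[OF assms, where vs = "[1, 2, 3, 8, 6, 5, 4, 7]"])
    (simp_all add: R_8_2_adj_def catalogue_simps)

lemma graph_iso_R_8_3:
  assumes "pair_wf_digraph G" "adjacency_labelling R_8_3_adj c G"
  shows "graph_iso G R_8_3"
  by (rule graph_iso_adjacency_lists[OF assms, where vs = "[1, 5, 8, 2, 4, 7, 6, 3]"])
    (simp_all add: R_8_3_adj_def catalogue_simps)

lemma graph_iso_R_8_4: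
  assumes "pair_wf_digraph G" "adjacency_labelling R_8_4_adj c G"
  shows "graph_iso G R_8_4"
  by (rule graph_iso_adjacency_lists[OF assms, where vs = "[7, 8, 1, 3, 6, 2, 5, 4]"])
    (simp_all add: R_8_4_adj_def catalogue_simps)

lemma graph_iso_R_8_5:
  assumes "pair_wf_digraph G" "adjacency_labelling R_8_5_adj c G"
  shows "graph_iso G R_8_5"
  by (rule graph_iso_adjacency_lists[OF assms, where vs =
      "[(0, 0), (1, 0), (2, 0), (3, 0), (0, 1), (1, 1), (2, 1), (3, 1)]"])
    (simp_all add: R_8_5_adj_def catalogue_simps)

lemma graph_iso_R_8_6:
  assumes "pair_wf_digraph G" "adjacency_labelling R_8_6_adj c G"
  shows "graph_iso G R_8_6"
  by (rule graph_iso_adjacency_lists[OF assms, where vs = "[0, 1, 7, 2, 6, 3, 5, 4]"])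
    (simp_all add: R_8_6_adj_def catalogue_simps)

lemma graph_iso_complete_3_cycle_4:
  assumes "pair_wf_digraph G" "adjacency_labelling K3_C4_adj c G"
  shows "graph_iso G (complete_graph 3 \<box> cycle_graph 4)"
  by (rule graph_iso_adjacency_lists[OF assms, where vs =
      "[(0, 0), (2, 0), (1, 0), (0, 1), (0, 3), (2, 1), (2, 3), (1, 1), (1, 3), (0, 2), (2, 2), (1,
       2)]"])
    (simp_all add: K3_C4_adj_def catalogue_simps)

lemma graph_iso_complete_bipartite_3_3_complete_2:
  assumes "pair_wf_digraph G" "adjacency_labelling K33_K2_adj c G"
  shows "graph_iso G (complete_bipartite_graph 3 3 \<box> complete_graph 2)"
  by (rule graph_iso_adjacency_lists[OF assms, where vs =
      "[(Inl 0, 0), (Inr 1, 0), (Inr 2, 0), (Inr 0, 0), (Inl 0, 1), (Inl 1, 0), (Inl 2, 0), (Inr 1,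
       1), (Inr 2, 1), (Inr 0, 1), (Inl 1, 1), (Inl 2, 1)]"])
    (simp_all add: K33_K2_adj_def catalogue_simps)

lemma graph_iso_R_10_2:
  assumes "pair_wf_digraph G" "adjacency_labelling R_10_2_adj c G"
  shows "graph_iso G R_10_2"
  by (rule graph_iso_adjacency_lists[OF assms, where vs = "[9, 2, 6, 4, 8, 3, 1, 5, 7, 10]"])
    (simp_all add: R_10_2_adj_def catalogue_simps)

lemma graph_iso_R_10_3:
  assumes "pair_wf_digraph G" "adjacency_labelling R_10_3_adj c G"
  shows "graph_iso G R_10_3"
  by (rule graph_iso_adjacency_lists[OF assms, where vs = "[1, 2, 3, 4, 5, 8, 10, 9, 6, 7]"])
    (simp_all add: R_10_3_adj_def catalogue_simps)

lemma graph_iso_R_10_4: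
  assumes "pair_wf_digraph G" "adjacency_labelling R_10_4_adj c G"
  shows "graph_iso G R_10_4"
  by (rule graph_iso_adjacency_lists[OF assms, where vs = "[0, 1, 3, 9, 7, 2, 4, 8, 6, 5]"])
    (simp_all add: R_10_4_adj_def catalogue_simps)

lemma graph_iso_R_12_3:
  assumes "pair_wf_digraph G" "adjacency_labelling R_12_3_adj c G"
  shows "graph_iso G R_12_3"
  by (rule graph_iso_adjacency_lists[OF assms, where vs =
      "[0, 11, 1, 9, 3, 10, 2, 8, 4, 6, 7, 5]"])
    (simp_all add: R_12_3_adj_def catalogue_simps)

lemma graph_iso_R_14_1:
  assumes "pair_wf_digraph G" "adjacency_labelling R_14_1_adj c G"
  shows "graph_iso G R_14_1"
  by (rule graph_iso_adjacency_lists[OF assms, where vs =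
      "[1, 10, 13, 14, 8, 4, 5, 3, 7, 6, 2, 11, 9, 12]"])
    (simp_all add: R_14_1_adj_def catalogue_simps)

lemma graph_iso_hypercube4:
  assumes "pair_wf_digraph G" "adjacency_labelling Q4_adj c G"
  shows "graph_iso G hypercube4"
  by (rule graph_iso_adjacency_lists[OF assms, where vs =
      "[(((0, 0), 0), 0), (((1, 0), 0), 0), (((0, 0), 0), 1), (((0, 0), 1), 0), (((0, 1), 0), 0),
       (((1, 0), 0), 1), (((1, 0), 1), 0), (((1, 1), 0), 0), (((0, 0), 1), 1), (((0, 1), 0), 1),
       (((0, 1), 1), 0), (((1, 0), 1), 1), (((1, 1), 0), 1), (((1, 1), 1), 0), (((0, 1), 1), 1),
       (((1, 1), 1), 1)]"])
    (simp_all add: Q4_adj_def catalogue_simps)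

lemma graph_iso_closed_candle_3:
  assumes "pair_wf_digraph G" "adjacency_labelling H3_adj c G"
  shows "graph_iso G (closed_candle 3)"
  by (rule graph_iso_adjacency_lists[OF assms, where vs = "[1, 3, 5, 6, 4, 2]"])
    (simp_all add: H3_adj_def catalogue_simps)

lemma graph_iso_closed_candle_4:
  assumes "pair_wf_digraph G" "adjacency_labelling H4_adj c G"
  shows "graph_iso G (closed_candle 4)"
  by (rule graph_iso_adjacency_lists[OF assms, where vs = "[1, 3, 4, 7, 8, 2, 5, 6]"])
    (simp_all add: H4_adj_def catalogue_simps)

lemma graph_iso_closed_candle_5:
  assumes "pair_wf_digraph G" "adjacency_labelling H5_adj c G"
  shows "graph_iso G (closed_candle 5)"
  by (rule graph_iso_adjacency_lists[OF assms, where vs = "[1, 9, 10, 3, 4, 2, 7, 8, 5, 6]"])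
    (simp_all add: H5_adj_def catalogue_simps)

lemmas graph_isos =
  graph_iso_complete_5 graph_iso_R_7_1 graph_iso_R_8_2 graph_iso_R_8_3 graph_iso_R_8_4
  graph_iso_R_8_5 graph_iso_R_8_6 graph_iso_complete_3_cycle_4
  graph_iso_complete_bipartite_3_3_complete_2 graph_iso_R_10_2 graph_iso_R_10_3 graph_iso_R_10_4
  graph_iso_R_12_3 graph_iso_R_14_1 graph_iso_hypercube4 graph_iso_closed_candle_3
  graph_iso_closed_candle_4 graph_iso_closed_candle_5

section \<open>The classification\<close>

lemma (in pair_graph) card_adj_eq_out_degree: "card {v. adj u v} = out_degree (with_proj G) u"
proof -
  have "out_arcs (with_proj G) u = Pair u ` {v. adj u v}" by (auto simp: out_arcs_def)
  then show ?thesis unfolding out_degree_def by (simp add: card_image inj_on_def)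
qed

theorem theorem2p4:
  fixes G :: "'a pair_pre_digraph"
  assumes "pair_graph G"
    and "Digraph_Component.connected (with_proj G)"
    and "\<forall>v \<in> pverts G. out_degree (with_proj G) v = 4"
    and "q_graph G = 2"
  shows "graph_iso G (complete_graph 5)
    \<or> (graph_iso G R_7_1 \<or> graph_iso G R_8_2 \<or> graph_iso G R_8_3 \<or> graph_iso G R_8_4
        \<or> graph_iso G R_8_5 \<or> graph_iso G R_8_6)
    \<or> (graph_iso G (complete_graph 3 \<box> cycle_graph 4)
        \<or> graph_iso G (complete_bipartite_graph 3 3 \<box> complete_graph 2)
        \<or> graph_iso G R_10_2 \<or> graph_iso G R_10_3 \<or> graph_iso G R_10_4
        \<or> graph_iso G R_12_3 \<or> graph_iso G R_14_1)
    \<or> graph_iso G hypercube4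
    \<or> (\<exists>k\<ge>3. graph_iso G (closed_candle k))"
proof -
  interpret pair_graph G by fact
  obtain w d where "two_eigenvalue_weighting G w d"
    by (rule two_eigenvalue_weighting_if_q_graph_2[OF assms(4)])
  then interpret two_eigenvalue_weighting G w d .
  interpret quadrangular_graph G 4
    by (rule quadrangular_graph_if_regular) (use assms(3) in \<open>simp add: card_adj_eq_out_degree\<close>)
  interpret quartic_quadrangular_graph G by unfold_locales (rule assms(2))
  show ?thesis
  proof (rule closed_candle_or_adjacency_labelling)
    fix A c assume A: "A \<in> set (catalogue @ spurious)" and c: "adjacency_labelling A c G"
    then interpret labelled_two_eigenvalue_weighting G w d A c by unfold_locales
    have "A \<in> set catalogue" using A not_spurious by simp
    then show ?thesis
      unfolding catalogue_def using c pair_wf_digraph by (auto dest: graph_isos)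
  qed blast
qed

end
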